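(* Let $\mathcal{H}_A,\mathcal{H}_B$ be finite-dimensional Hilbert spaces with $d_A=\dim\mathcal{H}_A$, $d_B=\dim\mathcal{H}_B$, let $n\in\mathbb{N}$, and let $\rho_{AB}\in\mathcal{S}(\mathcal{H}_A\otimes\mathcal{H}_B)$ be a state that admits a permutation-invariant double-sided $n$-extension. Then there exists a separable state $\tilde\rho_{AB}\in\mathrm{SEP}(A:B)$ such that $$\lVert\rho_{AB}-\tilde\rho_{AB}\rVert_1\le4d_Ad_B\,\frac{\sqrt{2\ln2\,(d_A^2-1)\log(n+d_A)}}{n}.$$
   Context: $\log$ is base 2, $\lVert\cdot\rVert_1$ is the trace norm. $\mathrm{SEP}(A:B)=\mathrm{conv}\{\rho_A\otimes\sigma_B\}$ over states $\rho_A,\sigma_B$. $\rho_{AB}$ admits a permutation-invariant double-sided $n$-extension if there is a state $\rho_{A_1^nB_1^n}\in\mathcal{S}(\mathcal{H}_A^{\otimes n}\otimes\mathcal{H}_B^{\otimes n})$ that is invariant under conjugation by $U_{A_1^n}(\sigma)\otimes1$ and by $1\otimes U_{B_1^n}(\sigma)$ for all $\sigma\in S_n$ (where $U(\sigma)$ permutes tensor factors) and satisfies $\rho_{A_1B_1}=\rho_{AB}$. *)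

theory Defs
  imports "HOL-Analysis.Analysis"
begin

text \<open>
  A finite-dimensional Hilbert space is the space of complex vectors over a finite index type:
  the indices are an orthonormal basis, and \<^term>\<open>CARD('i)\<close> is the dimension. Its operators are
  the square matrices over that type. The basis of a tensor product is the product of the bases.
  The tensor power with one factor for each element of \<^typ>\<open>'n\<close> has as its basis the functions
  from \<^typ>\<open>'n\<close> to the basis of a single factor.
\<close>

type_synonym 'i operator = "complex ^ 'i ^ 'i"

definition dagger :: "'i operator \<Rightarrow> ('i::finite) operator" where
  "dagger M = (\<chi> i j. cnj (M $ j $ i))"

definition psd :: "('i::finite) operator \<Rightarrow> bool" where
  "psd M \<longleftrightarrow> dagger M = M \<and> (\<forall>v. 0 \<le> Re (\<Sum>i\<in>UNIV. cnj (v $ i) * (M *v v) $ i))"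

definition density_op :: "('i::finite) operator \<Rightarrow> bool" where
  "density_op \<rho> \<longleftrightarrow> psd \<rho> \<and> trace \<rho> = 1"

definition psd_sqrt :: "'i operator \<Rightarrow> ('i::finite) operator" where
  "psd_sqrt M = (THE P. psd P \<and> P ** P = M)"

definition trace_norm :: "('i::finite) operator \<Rightarrow> real" where
  "trace_norm M = Re (trace (psd_sqrt (dagger M ** M)))"

definition tensor_op ::
    "'a operator \<Rightarrow> 'b operator \<Rightarrow> ('a::finite \<times> 'b::finite) operator" where
  "tensor_op M N = (\<chi> p q. M $ fst p $ fst q * N $ snd p $ snd q)"

definition SEP :: "('a::finite \<times> 'b::finite) operator set" where
  "SEP = convex hull {tensor_op \<rho> \<sigma> |\<rho> \<sigma>. density_op \<rho> \<and> density_op \<sigma>}"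

text \<open>
  On basis vectors, \<open>perm_op \<sigma>\<close> sends \<open>f\<close> to \<open>f \<circ> inv \<sigma>\<close>: the content of factor \<open>k\<close> moves to
  factor \<open>\<sigma> k\<close>.
\<close>

definition perm_op :: "('n \<Rightarrow> 'n) \<Rightarrow> ('n::finite \<Rightarrow> 'a::finite) operator" where
  "perm_op \<sigma> = (\<chi> f g. if g = f \<circ> \<sigma> then 1 else 0)"

text \<open>
  Partial trace over all factors but factor \<open>k\<close> of the first tensor power and factor \<open>l\<close> of the
  second: the row and the column index agree everywhere else.
\<close>

definition marginal ::
    "'n \<Rightarrow> 'n \<Rightarrow> (('n::finite \<Rightarrow> 'a::finite) \<times> ('n \<Rightarrow> 'b::finite)) operator \<Rightarrow> ('a \<times> 'b) operator"
  where
  "marginal k l R = (\<chi> p q. \<Sum>(f, g) \<in> {(f, g). f k = fst p \<and> g l = snd p}.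
      R $ (f, g) $ (f(k := fst q), g(l := snd q)))"

text \<open>
  The number \<open>n\<close> of copies is \<^term>\<open>CARD('n)\<close>; the linear order on \<^typ>\<open>'n\<close> only serves to single
  out the first factor, \<^term>\<open>Min UNIV\<close>.
\<close>

definition perm_inv_extension ::
    "(('n::{finite,linorder} \<Rightarrow> 'a::finite) \<times> ('n \<Rightarrow> 'b::finite)) operator
      \<Rightarrow> ('a \<times> 'b) operator \<Rightarrow> bool" where
  "perm_inv_extension R \<rho> \<longleftrightarrow>
     density_op R \<and>
     (\<forall>\<sigma>. \<sigma> permutes UNIV \<longrightarrow>
        tensor_op (perm_op \<sigma>) (mat 1) ** R ** dagger (tensor_op (perm_op \<sigma>) (mat 1)) = R) \<and>
     (\<forall>\<sigma>. \<sigma> permutes UNIV \<longrightarrow>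
        tensor_op (mat 1) (perm_op \<sigma>) ** R ** dagger (tensor_op (mat 1) (perm_op \<sigma>)) = R) \<and>
     marginal (Min UNIV) (Min UNIV) R = \<rho>"

definition admits_perm_inv_extension ::
    "('n::{finite,linorder}) itself \<Rightarrow> ('a::finite \<times> 'b::finite) operator \<Rightarrow> bool" where
  "admits_perm_inv_extension _ \<rho> \<longleftrightarrow>
     (\<exists>R :: (('n \<Rightarrow> 'a) \<times> ('n \<Rightarrow> 'b)) operator. perm_inv_extension R \<rho>)"

end

theory Submission
  imports Defs
begin

text \<open>
  Let \<open>d\<close> be the dimension of the first factor, \<open>R\<close> the extension and \<open>S\<close> its square root, which
  commutes with the permutations of the first \<open>n\<close> factors. For a random \<open>d \<times> d\<close> matrix \<open>G\<close> with
  independent standard complex Gaussian entries, let \<open>V\<^bsub>G\<^esub>\<close> be the contraction of \<open>S\<close> with the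
  conjugate of the \<open>n\<close>-fold tensor power of \<open>G\<close>, an operator on the second tensor power. By Wick's
  theorem the expectation of the separable operator
  \<open>G G\<^sup>* \<otimes> V\<^bsub>G\<^esub> V\<^bsub>G\<^esub>\<^sup>*\<close>, reduced to one copy of the second factor, is
  \<open>n! (n \<rho> + d (1 \<otimes> tr\<^sub>A \<rho>))\<close>: the contraction of the first \<open>G\<close> with the first \<open>G\<^sup>*\<close> gives the
  second term, and the remaining ones give the first. Hence a multiple of this operator is a
  separable state, and its distance from \<open>\<rho>\<close> is at most \<open>2 d\<^sup>2 / (n + d\<^sup>2)\<close>. Only finitely many
  moments of the Gaussian enter, so it can be replaced by a finitely supported distribution.
\<close>

section \<open>Hermitian operators\<close>

text \<open>A maximiser of the quadratic form \<open>x \<bullet> f x\<close> on the unit sphere of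
  \<open>S\<close>, which exists by compactness, is an eigenvector, with the maximum as its
  eigenvalue.\<close>

lemma selfadjoint_eigenvector_in_subspace:
  fixes f :: "'a::euclidean_space \<Rightarrow> 'a"
  assumes lin: "linear f" and sa: "\<And>x y. f x \<bullet> y = x \<bullet> f y"
    and S: "subspace S" and inv: "f ` S \<subseteq> S" and ne: "S \<noteq> {0}"
  obtains x c where "x \<in> S" "norm x = 1" "f x = c *\<^sub>R x"
proof -
  interpret linear f by (fact lin)
  have "compact (S \<inter> sphere 0 1)"
    using S by (metis closed_subspace compact_sphere closed_Int_compact)
  moreover have "S \<inter> sphere 0 1 \<noteq> {}"
  proof -
    obtain y where "y \<in> S" "y \<noteq> 0" using ne S subspace_0 by blast
    then have "(1 / norm y) *\<^sub>R y \<in> S \<inter> sphere 0 1"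
      using S by (auto intro: subspace_scale)
    then show ?thesis by blast
  qed
  moreover have "continuous_on (S \<inter> sphere 0 1) (\<lambda>x. x \<bullet> f x)"
    by (intro continuous_on_inner continuous_on_id linear_continuous_on)
      (simp add: lin flip: linear_conv_bounded_linear)
  ultimately have "\<exists>x\<in>S \<inter> sphere 0 1. \<forall>y\<in>S \<inter> sphere 0 1. y \<bullet> f y \<le> x \<bullet> f x"
    by (rule continuous_attains_sup)
  then obtain x where "x \<in> S \<inter> sphere 0 1"
    and max': "\<forall>y\<in>S \<inter> sphere 0 1. y \<bullet> f y \<le> x \<bullet> f x" by (elim bexE)
  then have x: "x \<in> S" "norm x = 1" by simp_all
  have max: "y \<bullet> f y \<le> x \<bullet> f x" if "y \<in> S" "norm y = 1" for y
    using bspec[OF max', of y] that by simp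
  define c where "c = x \<bullet> f x"
  have form: "y \<bullet> f y \<le> c * (y \<bullet> y)" if "y \<in> S" for y
  proof (cases "y = 0")
    case False
    have "(y /\<^sub>R norm y) \<bullet> f (y /\<^sub>R norm y) \<le> c"
      unfolding c_def using False S that by (intro max) (auto intro: subspace_scale)
    then have "(y \<bullet> f y) / (norm y)\<^sup>2 \<le> c"
      by (simp add: scale power2_eq_square divide_simps)
    then show ?thesis using False by (simp add: field_simps power2_norm_eq_inner)
  qed simp
  \<comment> \<open>The residual \<open>y\<close> lies in \<open>S\<close>, so moving from
    \<open>x\<close> in its direction cannot raise the form above \<open>c\<close>. The first-order
    gain is \<open>2 * t * (y \<bullet> y)\<close>, which must therefore vanish.\<close>
  have "f x - c *\<^sub>R x = 0"
  proof -
    define y where "y = f x - c *\<^sub>R x"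
    have yS: "y \<in> S" unfolding y_def using x inv S by (auto intro!: subspace_diff subspace_scale)
    define g where "g = (y \<bullet> f y) - c * (y \<bullet> y)"
    have xx: "x \<bullet> x = 1" using x by (simp add: dot_square_norm)
    have "2 * t * (y \<bullet> y) + t\<^sup>2 * g \<le> 0" for t
    proof -
      have "x + t *\<^sub>R y \<in> S" using x yS S by (auto intro!: subspace_add subspace_scale)
      from form[OF this]
      have "c + 2 * t * (y \<bullet> f x) + t\<^sup>2 * (y \<bullet> f y)
          \<le> c * (1 + 2 * t * (x \<bullet> y) + t\<^sup>2 * (y \<bullet> y))"
        using sa[of x y] xx
        by (simp add: add scale inner_add_left inner_add_right c_def[symmetric] power2_eq_square
            inner_commute algebra_simps)
      moreover have "y \<bullet> f x = y \<bullet> y + c * (x \<bullet> y)"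
        unfolding y_def by (simp add: inner_diff_left inner_diff_right inner_commute algebra_simps)
      ultimately show ?thesis by (simp add: g_def algebra_simps)
    qed
    note q = this
    have "y \<bullet> y \<le> 0"
    proof (rule ccontr)
      assume "\<not> y \<bullet> y \<le> 0"
      then have pos: "y \<bullet> y > 0" by (rule not_le_imp_less)
      \<comment> \<open>Small enough that the quadratic term cannot outweigh the linear one; the
        summand 1 covers \<open>g = 0\<close>.\<close>
      define t where "t = (y \<bullet> y) / (1 + \<bar>g\<bar>)"
      have t: "t > 0" unfolding t_def using pos by (simp add: add_pos_nonneg)
      have "t * (2 * (y \<bullet> y) + t * g) \<le> 0" using q[of t] by (simp add: algebra_simps power2_eq_square)
      then have "2 * (y \<bullet> y) + t * g \<le> 0" using t by (simp add: mult_le_0_iff)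
      moreover have "t * \<bar>g\<bar> \<le> y \<bullet> y"
        unfolding t_def using pos by (simp add: field_simps)
      moreover have "- (t * g) \<le> t * \<bar>g\<bar>" using t by (simp add: abs_if)
      ultimately show False using pos by linarith
    qed
    then show ?thesis unfolding y_def by (metis inner_ge_zero inner_eq_zero_iff order_antisym)
  qed
  then show ?thesis using that[of x c] x by simp
qed

text \<open>Induction on the dimension: split off one unit eigenvector and pass to its orthogonal
  complement in \<open>S\<close>, which self-adjointness keeps invariant.\<close>

lemma selfadjoint_eigenbasis_of_subspace:
  fixes f :: "'a::euclidean_space \<Rightarrow> 'a"
  assumes lin: "linear f" and sa: "\<And>x y. f x \<bullet> y = x \<bullet> f y"
    and "subspace S" and "f ` S \<subseteq> S"
  shows "\<exists>B c. B \<subseteq> S \<and> pairwise orthogonal B \<and> (\<forall>b\<in>B. norm b = 1 \<and> f b = c b *\<^sub>R b) \<and> S \<subseteq> span B"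
  using assms(3,4)
proof (induction "dim S" arbitrary: S rule: less_induct)
  case less
  show ?case
  proof (cases "S = {0}")
    case True
    then show ?thesis by (intro exI[of _ "{}"]) auto
  next
    case False
    obtain x c where x: "x \<in> S" "norm x = 1" "f x = c *\<^sub>R x"
      using selfadjoint_eigenvector_in_subspace[OF lin sa less.prems False] by metis
    define S' where "S' = {y \<in> S. orthogonal x y}"
    have S': "subspace S'"
      unfolding S'_def using less.prems(1)
      by (auto simp: subspace_def orthogonal_def inner_add_right)
    have "f ` S' \<subseteq> S'"
    proof (clarsimp simp: S'_def orthogonal_def)
      fix y assume "y \<in> S" "x \<bullet> y = 0"
      then show "f y \<in> S \<and> x \<bullet> f y = 0"
        using less.prems(2) x(3) sa[of x y] by auto
    qed
    moreover have "dim S' < dim S"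
    proof (rule dim_psubset)
      have "x \<notin> S'" using x by (auto simp: S'_def orthogonal_def dot_square_norm)
      then have "S' \<subset> S" using x by (auto simp: S'_def)
      then show "span S' \<subset> span S"
        using S' less.prems(1) by (metis span_eq_iff)
    qed
    ultimately obtain B d where B: "B \<subseteq> S'" "pairwise orthogonal B"
      "\<forall>b\<in>B. norm b = 1 \<and> f b = d b *\<^sub>R b" "S' \<subseteq> span B"
      using less.hyps[of S'] S' by blast
    have xB: "x \<notin> B" using B(1) x by (auto simp: S'_def orthogonal_def dot_square_norm)
    show ?thesis
    proof (intro exI conjI)
      show "insert x B \<subseteq> S" using B x by (auto simp: S'_def)
      show "pairwise orthogonal (insert x B)"
        using B(1,2) by (auto simp: pairwise_insert S'_def orthogonal_commute)
      show "\<forall>b\<in>insert x B. norm b = 1 \<and> f b = (d(x := c)) b *\<^sub>R b"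
        using B(3) x xB by auto
      show "S \<subseteq> span (insert x B)"
      proof
        fix y assume y: "y \<in> S"
        have "y - (x \<bullet> y) *\<^sub>R x \<in> S'"
          using x y less.prems(1)
          by (auto simp: S'_def orthogonal_def inner_diff_right dot_square_norm
              intro!: subspace_diff subspace_scale)
        then show "y \<in> span (insert x B)"
          using B(4) unfolding span_breakdown_eq by blast
      qed
    qed
  qed
qed

lemma inner_vec_complex:
  fixes x y :: "complex ^ 'i"
  shows "x \<bullet> y = Re (\<Sum>i\<in>UNIV. cnj (x $ i) * y $ i)"
  by (simp add: inner_vec_def inner_complex_def)

text \<open>The Euclidean inner product of complex vectors is the real part of the Hermitian form,
  so \<open>dagger\<close> is also the adjoint for the real structure. This lets the real spectral
  theorem above serve Hermitian matrices.\<close>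

lemma inner_dagger:
  fixes M :: "('i::finite) operator"
  shows "(dagger M *v x) \<bullet> y = x \<bullet> (M *v y)"
proof -
  have "(\<Sum>i\<in>UNIV. cnj ((dagger M *v x) $ i) * y $ i)
      = (\<Sum>i\<in>UNIV. \<Sum>j\<in>UNIV. M $ j $ i * cnj (x $ j) * y $ i)"
    by (simp add: matrix_vector_mult_def dagger_def sum_distrib_right)
  also have "\<dots> = (\<Sum>j\<in>UNIV. \<Sum>i\<in>UNIV. M $ j $ i * cnj (x $ j) * y $ i)"
    by (rule sum.swap)
  also have "\<dots> = (\<Sum>j\<in>UNIV. cnj (x $ j) * (M *v y) $ j)"
    by (simp add: matrix_vector_mult_def sum_distrib_left mult_ac)
  finally show ?thesis by (simp add: inner_vec_complex)
qed

lemma psd_iff_inner: "psd M \<longleftrightarrow> dagger M = M \<and> (\<forall>v. 0 \<le> v \<bullet> (M *v v))"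
  by (simp add: psd_def inner_vec_complex)

lemma linear_operator: "linear ((*v) (M :: ('i::finite) operator))"
  by (rule linearI)
    (simp_all add: vec_eq_iff matrix_vector_mult_def scaleR_sum_right sum.distrib distrib_left)

lemma scaleR_eq_scalar: "c *\<^sub>R (v :: complex ^ 'i) = complex_of_real c *s v"
  unfolding vec_eq_iff vector_scaleR_component by (simp add: scaleR_conv_of_real)

text \<open>Orthogonality and span are over the reals, so \<open>B\<close> has twice as many
  elements as the complex dimension.\<close>

definition eigenbasis :: "(complex ^ 'i) set \<Rightarrow> (complex ^ 'i \<Rightarrow> real) \<Rightarrow> ('i::finite) operator \<Rightarrow> bool" where
  "eigenbasis B c M \<longleftrightarrow> finite B \<and> pairwise orthogonal B \<and> span B = UNIV \<and>
     (\<forall>b\<in>B. norm b = 1 \<and> M *v b = c b *\<^sub>R b)"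

lemma hermitian_eigenbasis:
  assumes "dagger M = M"
  obtains B c where "eigenbasis B c M"
proof -
  have "(M *v x) \<bullet> y = x \<bullet> (M *v y)" for x y
    using inner_dagger[of M x y] assms by simp
  from selfadjoint_eigenbasis_of_subspace[OF linear_operator this subspace_UNIV subset_UNIV]
  obtain B c where B: "pairwise orthogonal B"
    "\<forall>b\<in>B. norm b = 1 \<and> M *v b = c b *\<^sub>R b" "UNIV \<subseteq> span B"
    by (elim exE conjE)
  show ?thesis
  proof (rule that)
    show "eigenbasis B c M"
      unfolding eigenbasis_def
      using B pairwise_orthogonal_imp_finite[OF B(1)] top.extremum_unique by blast
  qed
qed

lemma eigenbasis_expansion:
  assumes "eigenbasis B c M"
  shows "(\<Sum>b\<in>B. (b \<bullet> v) *\<^sub>R b) = v"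
proof -
  have B: "finite B" "pairwise orthogonal B" "span B = UNIV" "\<And>b. b \<in> B \<Longrightarrow> norm b = 1"
    using assms by (auto simp: eigenbasis_def)
  have "(v - (\<Sum>b\<in>B. (b \<bullet> v / (b \<bullet> b)) *\<^sub>R b)) \<bullet> x = 0" for x
    using Gram_Schmidt_step[OF B(2), of x v] B(3) by (simp add: orthogonal_def inner_commute)
  then have "v - (\<Sum>b\<in>B. (b \<bullet> v / (b \<bullet> b)) *\<^sub>R b) = 0"
    using inner_eq_zero_iff by blast
  then show ?thesis using B(4) by (simp add: dot_square_norm)
qed

lemma operator_eqI_eigenbasis:
  fixes P Q :: "('i::finite) operator"
  assumes "eigenbasis B c M" and "\<And>b. b \<in> B \<Longrightarrow> P *v b = Q *v b"
  shows "P = Q"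
proof -
  have "P *v v = Q *v v" for v
    using assms linear_eq_on_span[OF linear_operator linear_operator, of B P Q v]
    by (auto simp: eigenbasis_def)
  then show ?thesis by (simp add: matrix_eq)
qed

lemma eigenbasis_inner:
  assumes B: "eigenbasis B c M" and T: "\<And>b. b \<in> B \<Longrightarrow> T *v b = t b *\<^sub>R b"
  shows "v \<bullet> (T *v v) = (\<Sum>b\<in>B. t b * (b \<bullet> v)\<^sup>2)"
proof -
  interpret linear "(*v) T" by (rule linear_operator)
  have "T *v v = T *v (\<Sum>b\<in>B. (b \<bullet> v) *\<^sub>R b)" using eigenbasis_expansion[OF B, of v] by simp
  also have "\<dots> = (\<Sum>b\<in>B. (b \<bullet> v) *\<^sub>R t b *\<^sub>R b)"
    by (simp add: sum scale T cong: sum.cong)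
  finally show ?thesis by (simp add: inner_sum_right inner_commute power2_eq_square mult_ac)
qed

text \<open>The operator is defined on a real eigenbasis, but described by its action on all
  eigenvectors of \<open>M\<close>, which does not depend on that basis. It must also be shown
  complex linear in order to be a matrix.\<close>

lemma hermitian_functional_calculus:
  fixes M :: "('i::finite) operator"
  assumes M: "dagger M = M"
  shows "\<exists>T. dagger T = T \<and> (\<forall>v c. M *v v = c *\<^sub>R v \<longrightarrow> T *v v = h c *\<^sub>R v)"
proof -
  obtain B c where B: "eigenbasis B c M" using hermitian_eigenbasis[OF M] .
  define f where "f v = (\<Sum>b\<in>B. (h (c b) * (b \<bullet> v)) *\<^sub>R b)" for v
  have lin: "linear f"
    unfolding f_def
    by (rule linearI) (simp_all add: inner_add_right algebra_simps sum.distrib scaleR_sum_right)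
  have sa: "f x \<bullet> y = x \<bullet> f y" for x y
    by (simp add: f_def inner_sum_left inner_sum_right inner_commute mult_ac)
  \<comment> \<open>Eigenvectors for different eigenvalues are orthogonal, so only basis vectors
    with eigenvalue \<open>d\<close> enter the expansion of \<open>v\<close>.\<close>
  have f_eigen: "f v = h d *\<^sub>R v" if v: "M *v v = d *\<^sub>R v" for v d
  proof -
    have "h (c b) * (b \<bullet> v) = h d * (b \<bullet> v)" if "b \<in> B" for b
    proof -
      have "c b * (b \<bullet> v) = (M *v b) \<bullet> v" using B that by (simp add: eigenbasis_def)
      also have "\<dots> = d * (b \<bullet> v)" using inner_dagger[of M b v] M v by simp
      finally show ?thesis by auto
    qed
    then have "f v = (\<Sum>b\<in>B. h d *\<^sub>R (b \<bullet> v) *\<^sub>R b)" unfolding f_def by (intro sum.cong) auto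
    also have "\<dots> = h d *\<^sub>R v"
      by (simp only: eigenbasis_expansion[OF B] flip: scaleR_sum_right)
    finally show ?thesis .
  qed
  interpret f: linear f by (fact lin)
  \<comment> \<open>Multiplying a basis vector by \<open>\<i>\<close> gives an eigenvector of
    \<open>M\<close> with the same eigenvalue, so \<open>f\<close> commutes with \<open>\<i>\<close>
    on the basis and hence everywhere.\<close>
  have i: "f (\<i> *s v) = \<i> *s f v" for v
  proof -
    have "f (\<i> *s b) = \<i> *s f b" if "b \<in> B" for b
    proof -
      have b: "M *v b = c b *\<^sub>R b" using B that by (simp add: eigenbasis_def)
      then have ib: "M *v (\<i> *s b) = c b *\<^sub>R (\<i> *s b)"
        by (simp add: vector_scalar_commute scaleR_eq_scalar mult.commute)
      show ?thesis using f_eigen[OF ib] f_eigen[OF b]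
        by (simp add: scaleR_eq_scalar mult.commute)
    qed
    moreover have "linear ((*s) \<i> :: complex ^ 'i \<Rightarrow> _)"
      by (rule linearI) (simp_all add: vec_eq_iff algebra_simps)
    then have "linear (f \<circ> (*s) \<i>)" "linear ((*s) \<i> \<circ> f)"
      using lin by (simp_all only: linear_compose)
    ultimately show ?thesis
      using linear_eq_on_span[of "f \<circ> (*s) \<i>" "(*s) \<i> \<circ> f" B v] B
      by (auto simp: eigenbasis_def)
  qed
  have "f (z *s v) = z *s f v" for z v
  proof -
    have "z *s v = Re z *\<^sub>R v + Im z *\<^sub>R (\<i> *s v)" for v :: "complex ^ 'i"
      by (simp add: vec_eq_iff complex_eq_iff)
    then show ?thesis by (simp add: f.add f.scale i)
  qed
  then have "Vector_Spaces.linear (*s) (*s) f"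
    by unfold_locales (simp_all add: f.add algebra_simps vector_add_ldistrib vector_sadd_rdistrib)
  then have works: "matrix f *v v = f v" for v by (rule matrix_works)
  have "(dagger (matrix f) *v v) \<bullet> y = (matrix f *v v) \<bullet> y" for v y
    by (simp add: inner_dagger works sa)
  then have "dagger (matrix f) *v v = matrix f *v v" for v
    using vector_eq_rdot by blast
  then have "dagger (matrix f) = matrix f" by (simp add: matrix_eq)
  then show ?thesis using works f_eigen by auto
qed

section \<open>Positive semidefinite operators and the trace norm\<close>

lemma psd_if_eigenbasis:
  assumes "eigenbasis B c M" "dagger T = T"
    and "\<And>b. b \<in> B \<Longrightarrow> T *v b = t b *\<^sub>R b" and "\<And>b. b \<in> B \<Longrightarrow> 0 \<le> t b"
  shows "psd T"
  using assms eigenbasis_inner[OF assms(1,3)] by (simp add: psd_iff_inner sum_nonneg)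

lemma psd_eigenvalue_nonneg:
  assumes "psd M" "M *v b = c *\<^sub>R b" "norm b = 1"
  shows "0 \<le> c"
  using assms by (auto simp: psd_iff_inner dot_square_norm dest!: spec[of _ b])

lemma mult_operator_vec: "(P ** Q) *v v = P *v (Q *v (v :: complex ^ 'i))"
  by (rule matrix_vector_mul_assoc[symmetric])

lemma dagger_mult: "dagger (M ** N) = dagger N ** dagger M"
  by (simp add: dagger_def matrix_matrix_mult_def vec_eq_iff mult.commute)

text \<open>Uniqueness of the positive root: an eigenvector of a rival root \<open>P\<close> with
  eigenvalue \<open>c\<close> is an eigenvector of \<open>M\<close> with eigenvalue the square of
  \<open>c\<close>, and there \<open>T\<close> acts as \<open>c\<close> because \<open>c\<close> is
  nonnegative.\<close>

lemma psd_sqrt_eqI: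
  assumes T: "psd T" "T ** T = M" "\<And>v c. M *v v = c *\<^sub>R v \<Longrightarrow> T *v v = sqrt c *\<^sub>R v"
  shows "psd_sqrt M = T"
  unfolding psd_sqrt_def
proof (rule the_equality)
  fix P assume P: "psd P \<and> P ** P = M"
  then obtain B c where B: "eigenbasis B c P"
    using hermitian_eigenbasis[of P] by (auto simp: psd_def)
  show "P = T"
  proof (rule operator_eqI_eigenbasis[OF B])
    fix b assume "b \<in> B"
    then have b: "P *v b = c b *\<^sub>R b" "norm b = 1" using B by (auto simp: eigenbasis_def)
    have "0 \<le> c b" using P b psd_eigenvalue_nonneg by blast
    have "M *v b = P *v (P *v b)" using P mult_operator_vec by metis
    also have "\<dots> = (c b)\<^sup>2 *\<^sub>R b"
      using b by (simp add: linear_scale[OF linear_operator] power2_eq_square)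
    finally have "T *v b = sqrt ((c b)\<^sup>2) *\<^sub>R b" by (rule T(3))
    then show "P *v b = T *v b" using b \<open>0 \<le> c b\<close> by simp
  qed
qed (use T in simp)

lemma psd_sqrt:
  assumes "psd M"
  shows psd_psd_sqrt: "psd (psd_sqrt M)"
    and psd_sqrt_square: "psd_sqrt M ** psd_sqrt M = M"
    and psd_sqrt_eigenvector: "\<And>v c. M *v v = c *\<^sub>R v \<Longrightarrow> psd_sqrt M *v v = sqrt c *\<^sub>R v"
proof -
  have M: "dagger M = M" using assms by (simp add: psd_def)
  obtain T where T: "dagger T = T" "\<And>v c. M *v v = c *\<^sub>R v \<Longrightarrow> T *v v = sqrt c *\<^sub>R v"
    using hermitian_functional_calculus[OF M, of sqrt] by blast
  obtain B c where B: "eigenbasis B c M" using hermitian_eigenbasis[OF M] .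
  have Bb: "M *v b = c b *\<^sub>R b" "norm b = 1" "0 \<le> c b" if "b \<in> B" for b
    using that B psd_eigenvalue_nonneg[OF assms, of b] by (auto simp: eigenbasis_def)
  have "psd T" using psd_if_eigenbasis[OF B T(1), of "\<lambda>b. sqrt (c b)"] T(2) Bb by simp
  moreover have "T ** T = M"
  proof (rule operator_eqI_eigenbasis[OF B])
    fix b assume "b \<in> B"
    then show "(T ** T) *v b = M *v b"
      using T(2)[OF Bb(1)] Bb by (simp add: mult_operator_vec linear_scale[OF linear_operator])
  qed
  moreover from calculation have "psd_sqrt M = T" using T(2) by (rule psd_sqrt_eqI)
  ultimately show "psd (psd_sqrt M)" "psd_sqrt M ** psd_sqrt M = M"
    "\<And>v c. M *v v = c *\<^sub>R v \<Longrightarrow> psd_sqrt M *v v = sqrt c *\<^sub>R v"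
    using T(2) by simp_all
qed

text \<open>An operator commuting with \<open>M\<close> maps each eigenspace of \<open>M\<close>
  into itself, and the root acts on that eigenspace as a scalar.\<close>

lemma psd_sqrt_commute:
  assumes "psd M" and "N ** M = M ** N"
  shows "N ** psd_sqrt M = psd_sqrt M ** N"
proof -
  obtain B c where B: "eigenbasis B c M"
    using hermitian_eigenbasis[of M] assms by (auto simp: psd_def)
  show ?thesis
  proof (rule operator_eqI_eigenbasis[OF B])
    fix b assume "b \<in> B"
    then have b: "M *v b = c b *\<^sub>R b" using B by (simp add: eigenbasis_def)
    have "M *v (N *v b) = N *v (M *v b)" using assms(2) by (metis mult_operator_vec)
    then have "M *v (N *v b) = c b *\<^sub>R (N *v b)"
      by (simp add: b linear_scale[OF linear_operator])
    then show "(N ** psd_sqrt M) *v b = (psd_sqrt M ** N) *v b"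
      using psd_sqrt_eigenvector[OF assms(1) b]
        psd_sqrt_eigenvector[OF assms(1), of "N *v b" "c b"]
      by (simp add: mult_operator_vec linear_scale[OF linear_operator])
  qed
qed

text \<open>The product of a rectangular matrix with its adjoint. The columns range over a set, so
  that partial traces and tensor products can enlarge or restrict the column index.\<close>

definition gram :: "('i \<Rightarrow> 'k \<Rightarrow> complex) \<Rightarrow> 'k set \<Rightarrow> ('i::finite) operator" where
  "gram v K = (\<chi> i j. \<Sum>k\<in>K. v i k * cnj (v j k))"

lemma gram_inner:
  "x \<bullet> (gram v K *v x) = (\<Sum>k\<in>K. (cmod (\<Sum>i\<in>UNIV. cnj (x $ i) * v i k))\<^sup>2)"
proof -
  have "(\<Sum>i\<in>UNIV. cnj (x $ i) * (gram v K *v x) $ i)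
      = (\<Sum>i\<in>UNIV. \<Sum>j\<in>UNIV. \<Sum>k\<in>K. (cnj (x $ i) * v i k) * cnj (cnj (x $ j) * v j k))"
    by (simp add: gram_def matrix_vector_mult_def sum_distrib_left sum_distrib_right mult_ac)
  also have "\<dots> = (\<Sum>k\<in>K. (\<Sum>i\<in>UNIV. cnj (x $ i) * v i k) * cnj (\<Sum>i\<in>UNIV. cnj (x $ i) * v i k))"
    unfolding cnj_sum sum_product by (subst sum.swap[of _ _ K])+ (auto intro: sum.swap)
  also have "\<dots> = (\<Sum>k\<in>K. complex_of_real ((cmod (\<Sum>i\<in>UNIV. cnj (x $ i) * v i k))\<^sup>2))"
    by (simp only: complex_norm_square)
  finally show ?thesis by (simp add: inner_vec_complex del: of_real_power)
qed

lemma psd_gram: "psd (gram v K)"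
  unfolding psd_iff_inner gram_inner
  by (simp add: sum_nonneg dagger_def gram_def vec_eq_iff mult.commute)

lemma trace_gram: "trace (gram v K) = complex_of_real (\<Sum>i\<in>UNIV. \<Sum>k\<in>K. (cmod (v i k))\<^sup>2)"
  by (simp add: trace_def gram_def complex_norm_square del: of_real_power)

lemma psd_eq_gram:
  assumes "psd M"
  shows "M = gram (\<lambda>i k. psd_sqrt M $ i $ k) UNIV"
proof -
  have "cnj (psd_sqrt M $ j $ k) = psd_sqrt M $ k $ j" for j k
    using psd_psd_sqrt[OF assms] by (auto simp: psd_def dagger_def vec_eq_iff)
  then show ?thesis
    using psd_sqrt_square[OF assms] by (auto simp: gram_def matrix_matrix_mult_def vec_eq_iff)
qed

lemma psd_gramE:
  fixes M :: "('i::finite) operator"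
  assumes "psd M"
  obtains v :: "'i \<Rightarrow> 'i \<Rightarrow> complex" where "M = gram v UNIV"
  using psd_eq_gram[OF assms] that by metis

lemma trace_psd: "psd M \<Longrightarrow> trace M = complex_of_real (Re (trace M)) \<and> 0 \<le> Re (trace M)"
  by (elim psd_gramE) (simp add: trace_gram sum_nonneg)

lemma psd_trace_eq_0:
  assumes "psd M" "Re (trace M) = 0"
  shows "M = 0"
proof -
  obtain v :: "'a \<Rightarrow> 'a \<Rightarrow> complex" where M: "M = gram v UNIV" using psd_gramE[OF assms(1)] .
  have "(\<Sum>i\<in>UNIV. \<Sum>k\<in>UNIV. (cmod (v i k))\<^sup>2) = 0" using assms(2) by (simp add: M trace_gram)
  then have "v i k = 0" for i k
    by (simp add: sum_nonneg_eq_0_iff sum_nonneg)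
  then show ?thesis by (simp add: M gram_def vec_eq_iff)
qed

text \<open>With \<open>Q\<close> written as a Gram operator, the trace is the sum of the quadratic
  form of \<open>P\<close> over the columns.\<close>

lemma trace_mult_psd_nonneg:
  assumes "psd P" "psd Q"
  shows "0 \<le> Re (trace (P ** Q))"
proof -
  obtain v :: "'a \<Rightarrow> 'a \<Rightarrow> complex" where Q: "Q = gram v UNIV" using psd_gramE[OF assms(2)] .
  have "trace (P ** Q) = (\<Sum>i\<in>UNIV. \<Sum>j\<in>UNIV. \<Sum>k\<in>UNIV. cnj (v i k) * (P $ i $ j * v j k))"
    by (simp add: Q trace_def gram_def matrix_matrix_mult_def sum_distrib_left mult_ac)
  also have "\<dots> = (\<Sum>i\<in>UNIV. \<Sum>k\<in>UNIV. \<Sum>j\<in>UNIV. cnj (v i k) * (P $ i $ j * v j k))"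
    by (intro sum.cong refl sum.swap)
  also have "\<dots> = (\<Sum>k\<in>UNIV. \<Sum>i\<in>UNIV. \<Sum>j\<in>UNIV. cnj (v i k) * (P $ i $ j * v j k))"
    by (rule sum.swap)
  also have "Re \<dots> = (\<Sum>k\<in>UNIV. (\<chi> i. v i k) \<bullet> (P *v (\<chi> i. v i k)))"
    by (simp add: inner_vec_complex matrix_vector_mult_def sum_distrib_left)
  finally show ?thesis using assms(1) by (simp add: psd_iff_inner sum_nonneg)
qed

lemma operator_mult_simps:
  fixes X Y Z :: "('i::finite) operator"
  shows "(X + Y) ** Z = X ** Z + Y ** Z" "(X - Y) ** Z = X ** Z - Y ** Z"
    "X ** (Y - Z) = X ** Y - X ** Z"
  by (simp_all add: matrix_matrix_mult_def vec_eq_iff algebra_simps sum.distrib sum_subtractf)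

text \<open>With \<open>U\<close> the sign of \<open>M = P - Q\<close>, the absolute value of
  \<open>M\<close> is \<open>U ** M\<close>. Since \<open>mat 1 - U\<close> and
  \<open>mat 1 + U\<close> are positive, the trace of \<open>U ** P\<close> is at most that of
  \<open>P\<close>, and the trace of \<open>U ** Q\<close> at least minus that of
  \<open>Q\<close>.\<close>

lemma trace_norm_diff_le:
  assumes P: "psd P" and Q: "psd Q"
  shows "trace_norm (P - Q) \<le> Re (trace P) + Re (trace Q)"
proof -
  define M where "M = P - Q"
  have M: "dagger M = M"
    using P Q by (auto simp: M_def psd_def dagger_def vec_eq_iff)
  obtain B c where B: "eigenbasis B c M" using hermitian_eigenbasis[OF M] .
  have Bb: "M *v b = c b *\<^sub>R b" if "b \<in> B" for b
    using that B by (auto simp: eigenbasis_def)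
  obtain U where U: "dagger U = U" "\<And>v c. M *v v = c *\<^sub>R v \<Longrightarrow> U *v v = sgn c *\<^sub>R v"
    using hermitian_functional_calculus[OF M, of sgn] by blast
  then have Ub: "U *v b = sgn (c b) *\<^sub>R b" if "b \<in> B" for b using that Bb by blast
  have psdMM: "psd (M ** M)"
  proof (rule psd_if_eigenbasis[OF B, where t = "\<lambda>b. (c b)\<^sup>2"])
    show "dagger (M ** M) = M ** M" by (simp add: dagger_mult M)
  qed (simp_all add: mult_operator_vec Bb linear_scale[OF linear_operator] power2_eq_square)
  have "psd_sqrt (M ** M) = U ** M"
  proof (rule operator_eqI_eigenbasis[OF B])
    fix b assume b: "b \<in> B"
    have "(M ** M) *v b = (c b)\<^sup>2 *\<^sub>R b"
      by (simp add: mult_operator_vec Bb[OF b] linear_scale[OF linear_operator] power2_eq_square)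
    from psd_sqrt_eigenvector[OF psdMM this] U(2)[OF Bb[OF b]]
    show "psd_sqrt (M ** M) *v b = (U ** M) *v b"
      by (simp add: mult_operator_vec Bb[OF b] linear_scale[OF linear_operator] abs_sgn)
  qed
  then have tn: "trace_norm M = Re (trace (U ** P)) - Re (trace (U ** Q))"
    by (simp add: trace_norm_def M) (simp add: M_def operator_mult_simps trace_sub)
  have one: "dagger (mat 1 :: 'a operator) = mat 1" by (auto simp: dagger_def mat_def vec_eq_iff)
  have "psd (mat 1 - U)"
  proof (rule psd_if_eigenbasis[OF B, where t = "\<lambda>b. 1 - sgn (c b)"])
    show "dagger (mat 1 - U) = mat 1 - U"
      using U(1) one by (auto simp: dagger_def vec_eq_iff)
  qed (auto simp: matrix_vector_mult_diff_rdistrib Ub algebra_simps sgn_if)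
  from trace_mult_psd_nonneg[OF this P] have "Re (trace (U ** P)) \<le> Re (trace P)"
    by (simp add: operator_mult_simps trace_sub)
  moreover have "psd (mat 1 + U)"
  proof (rule psd_if_eigenbasis[OF B, where t = "\<lambda>b. 1 + sgn (c b)"])
    show "dagger (mat 1 + U) = mat 1 + U"
      using U(1) one by (auto simp: dagger_def vec_eq_iff)
  qed (auto simp: matrix_vector_mult_add_rdistrib Ub algebra_simps sgn_if)
  from trace_mult_psd_nonneg[OF this Q] have "- Re (trace Q) \<le> Re (trace (U ** Q))"
    by (simp add: operator_mult_simps trace_add)
  ultimately show ?thesis using tn M_def by simp
qed

section \<open>Tensor products and separable sums\<close>

lemma tensor_gram:
  "tensor_op (gram v K) (gram w L)
    = gram (\<lambda>p q. v (fst p) (fst q) * w (snd p) (snd q)) (K \<times> L)"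
  by (simp add: tensor_op_def gram_def vec_eq_iff sum_product sum.cartesian_product
      case_prod_beta mult_ac)

lemma psd_tensor: "psd X \<Longrightarrow> psd Y \<Longrightarrow> psd (tensor_op X Y)"
  by (elim psd_gramE) (simp add: tensor_gram psd_gram)

lemma trace_tensor: "trace (tensor_op X Y) = trace X * trace Y"
  by (simp add: trace_def tensor_op_def sum_product sum.cartesian_product case_prod_beta
      flip: UNIV_Times_UNIV)

lemma psd_scaleR: "psd X \<Longrightarrow> 0 \<le> c \<Longrightarrow> psd (c *\<^sub>R X)"
proof -
  assume X: "psd X" and c: "0 \<le> c"
  have "(c *\<^sub>R X) *v v = c *\<^sub>R (X *v v)" for v
    by (simp add: vec_eq_iff matrix_vector_mult_def scaleR_sum_right)
  then have "0 \<le> v \<bullet> ((c *\<^sub>R X) *v v)" for v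
    using X c by (simp add: psd_iff_inner)
  then show ?thesis using X by (auto simp: psd_iff_inner dagger_def vec_eq_iff)
qed

lemma trace_scaleR: "trace (c *\<^sub>R (X :: ('i::finite) operator)) = c *\<^sub>R trace X"
  by (simp add: trace_def scaleR_sum_right)

lemma density_op_normalize:
  assumes "psd X" "Re (trace X) \<noteq> 0"
  shows "density_op ((1 / Re (trace X)) *\<^sub>R X)"
proof -
  have "psd ((1 / Re (trace X)) *\<^sub>R X)"
    using trace_psd[OF assms(1)] by (intro psd_scaleR assms(1)) simp
  moreover have "trace ((1 / Re (trace X)) *\<^sub>R X) = 1"
  proof -
    obtain r where r: "trace X = complex_of_real r" using trace_psd[OF assms(1)] by blast
    then show ?thesis using assms(2) by (simp add: trace_scaleR) (simp add: scaleR_conv_of_real)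
  qed
  ultimately show ?thesis by (simp add: density_op_def)
qed

text \<open>Dividing each factor by its trace moves the traces into the weights, which then add up
  to the trace of the whole sum, that is, to 1.\<close>

lemma sum_tensor_in_SEP:
  assumes fin: "finite T" and w: "\<And>t. t \<in> T \<Longrightarrow> 0 \<le> w t"
    and X: "\<And>t. t \<in> T \<Longrightarrow> psd (X t)" and Y: "\<And>t. t \<in> T \<Longrightarrow> psd (Y t)"
    and tr: "trace (\<Sum>t\<in>T. w t *\<^sub>R tensor_op (X t) (Y t)) = 1"
  shows "(\<Sum>t\<in>T. w t *\<^sub>R tensor_op (X t) (Y t)) \<in> SEP"
proof -
  define a where "a t = Re (trace (X t))" for t
  define b where "b t = Re (trace (Y t))" for t
  define u where "u t = w t * a t * b t" for t
  define e where "e t = tensor_op ((1 / a t) *\<^sub>R X t) ((1 / b t) *\<^sub>R Y t)" for t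
  define T' where "T' = {t \<in> T. a t \<noteq> 0 \<and> b t \<noteq> 0}"
  have scale: "w t *\<^sub>R tensor_op (X t) (Y t) = u t *\<^sub>R e t" if "t \<in> T'" for t
    using that by (simp add: T'_def u_def e_def tensor_op_def vec_eq_iff field_simps)
  \<comment> \<open>Terms that cannot be normalised contribute nothing, because a positive operator
    of trace zero vanishes.\<close>
  have "tensor_op (X t) (Y t) = 0" if "t \<in> T - T'" for t
    using that psd_trace_eq_0[OF X, of t] psd_trace_eq_0[OF Y, of t]
    by (auto simp: T'_def a_def b_def tensor_op_def vec_eq_iff)
  then have eq: "(\<Sum>t\<in>T. w t *\<^sub>R tensor_op (X t) (Y t)) = (\<Sum>t\<in>T'. u t *\<^sub>R e t)"
    using fin scale by (intro sum.mono_neutral_cong_right) (auto simp: T'_def)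
  have dens: "density_op ((1 / a t) *\<^sub>R X t)" "density_op ((1 / b t) *\<^sub>R Y t)" if "t \<in> T'" for t
    using that X Y by (auto simp: T'_def a_def b_def intro!: density_op_normalize)
  have tre: "trace (e t) = 1" if "t \<in> T'" for t
    using dens[OF that] by (simp add: e_def trace_tensor density_op_def)
  have trace_sum: "trace (\<Sum>t\<in>T'. u t *\<^sub>R e t) = (\<Sum>t\<in>T'. u t *\<^sub>R trace (e t))"
    unfolding trace_def by (simp add: scaleR_sum_right sum.swap[of _ T'])
  have "complex_of_real (sum u T') = 1"
    using tr tre unfolding eq trace_sum by (simp add: scaleR_conv_of_real)
  then have sum1: "sum u T' = 1" by (simp only: of_real_eq_1_iff)
  have "0 \<le> u t" if "t \<in> T'" for t
    using that w[of t] trace_psd[OF X, of t] trace_psd[OF Y, of t]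
    by (auto simp: T'_def u_def a_def b_def)
  moreover have "e t \<in> SEP" if "t \<in> T'" for t
    unfolding SEP_def e_def using dens[OF that] by (intro hull_inc) blast
  moreover have "finite T'" using fin by (simp add: T'_def)
  ultimately show ?thesis
    unfolding eq using sum1 by (intro convex_sum) (auto simp: SEP_def convex_convex_hull)
qed

section \<open>Finitely supported Wick calculus\<close>

text \<open>The moment \<open>E (z\<^sup>a cnj z\<^sup>b)\<close> of a standard complex Gaussian.\<close>

definition factorial_moment :: "nat \<Rightarrow> nat \<Rightarrow> complex" where
  "factorial_moment a b = (if a = b then fact a else 0)"

text \<open>Gaussian integration by parts in one variable. At \<open>b = 0\<close> the truncated
  subtraction is harmless because the factor \<open>of_nat b\<close> vanishes.\<close>

lemma factorial_moment_Suc: "factorial_moment (Suc a) b = of_nat b * factorial_moment a (b - 1)"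
  by (cases b) (auto simp: factorial_moment_def)

lemma prod_eq_prod_power:
  fixes k :: "'i \<Rightarrow> 'x::finite" and z :: "'x \<Rightarrow> complex"
  assumes "finite I"
  shows "(\<Prod>i\<in>I. z (k i)) = (\<Prod>y\<in>UNIV. z y ^ card {i \<in> I. k i = y})"
proof -
  have "(\<Prod>y\<in>UNIV. \<Prod>i\<in>{i \<in> I. k i = y}. z (k i)) = (\<Prod>i\<in>I. z (k i))"
    using assms by (intro prod.group) auto
  moreover have "(\<Prod>i\<in>{i \<in> I. k i = y}. z (k i)) = z y ^ card {i \<in> I. k i = y}" for y
    by simp
  ultimately show ?thesis by simp
qed

text \<open>A finitely supported measure on the complex plane with the same moments as the standard
  complex Gaussian, up to degree \<open>N\<close> in the variable and in its conjugate
  separately.\<close>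

locale wick_quadrature =
  fixes T :: "'t set" and w :: "'t \<Rightarrow> real" and Z :: "'t \<Rightarrow> complex" and N :: nat
  assumes finite_T: "finite T"
    and w_nonneg: "t \<in> T \<Longrightarrow> 0 \<le> w t"
    and moment: "a \<le> N \<Longrightarrow> b \<le> N \<Longrightarrow>
      (\<Sum>t\<in>T. of_real (w t) * (Z t ^ a * cnj (Z t) ^ b)) = factorial_moment a b"
begin

definition weight :: "('x::finite \<Rightarrow> 't) \<Rightarrow> real" where
  "weight \<omega> = (\<Prod>x\<in>UNIV. w (\<omega> x))"

text \<open>Expectation under the product measure, with one independent variable for each element of
  the index type.\<close>

definition expect :: "(('x::finite \<Rightarrow> complex) \<Rightarrow> complex) \<Rightarrow> complex" where
  "expect F = (\<Sum>\<omega>\<in>UNIV \<rightarrow>\<^sub>E T. of_real (weight \<omega>) * F (\<lambda>x. Z (\<omega> x)))"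

lemma finite_sample_space: "finite (UNIV \<rightarrow>\<^sub>E T :: ('x::finite \<Rightarrow> 't) set)"
  by (simp add: finite_PiE finite_T)

lemma weight_nonneg: "\<omega> \<in> UNIV \<rightarrow>\<^sub>E T \<Longrightarrow> 0 \<le> weight \<omega>"
  unfolding weight_def by (intro prod_nonneg) (auto intro: w_nonneg)

lemma expect_sum: "expect (\<lambda>z. \<Sum>a\<in>A. F a z) = (\<Sum>a\<in>A. expect (F a))"
  unfolding expect_def by (subst sum.swap) (simp add: sum_distrib_left)

lemma expect_mult_right: "expect (\<lambda>z. F z * c) = expect F * c"
  unfolding expect_def by (simp add: sum_distrib_right mult.assoc)

lemma expect_monomial:
  fixes a b :: "'x::finite \<Rightarrow> nat"
  assumes "\<And>x. a x \<le> N" "\<And>x. b x \<le> N"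
  shows "expect (\<lambda>z. \<Prod>x\<in>UNIV. z x ^ a x * cnj (z x) ^ b x) = (\<Prod>x\<in>UNIV. factorial_moment (a x) (b x))"
proof -
  have "(\<Prod>x\<in>UNIV. factorial_moment (a x) (b x))
      = (\<Prod>x\<in>UNIV. \<Sum>t\<in>T. of_real (w t) * (Z t ^ a x * cnj (Z t) ^ b x))"
    using assms by (simp add: moment)
  also have "\<dots> = (\<Sum>\<omega>\<in>UNIV \<rightarrow>\<^sub>E T. \<Prod>x\<in>UNIV. of_real (w (\<omega> x)) * (Z (\<omega> x) ^ a x * cnj (Z (\<omega> x)) ^ b x))"
    by (intro prod_sum_PiE) (simp_all add: finite_T)
  finally show ?thesis
    by (simp add: expect_def weight_def prod.distrib)
qed

text \<open>Collecting equal letters turns the two words into a monomial with exponents at most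
  \<open>N\<close>, whose expectation factors by independence.\<close>

lemma expect_word:
  fixes k :: "'i \<Rightarrow> 'x::finite" and l :: "'j \<Rightarrow> 'x"
  assumes "finite I" "card I \<le> N" "finite J" "card J \<le> N"
  shows "expect (\<lambda>z. (\<Prod>i\<in>I. z (k i)) * (\<Prod>j\<in>J. cnj (z (l j))))
    = (\<Prod>y\<in>UNIV. factorial_moment (card {i \<in> I. k i = y}) (card {j \<in> J. l j = y}))"
proof -
  have "card {i \<in> I. k i = y} \<le> N" "card {j \<in> J. l j = y} \<le> N" for y
    using assms card_mono[OF assms(1), of "{i \<in> I. k i = y}"]
      card_mono[OF assms(3), of "{j \<in> J. l j = y}"] by auto
  then show ?thesis
    using assms
    by (subst expect_monomial[symmetric])
      (auto simp: prod_eq_prod_power[of I] prod_eq_prod_power[of J "\<lambda>y. cnj (_ y)"] prod.distrib)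
qed

text \<open>Integration by parts for words: the letter \<open>z x\<close> is contracted with every
  matching conjugate letter in turn. Both sides are products of one-variable moments that differ
  only at \<open>x\<close>, where \<open>factorial_moment_Suc\<close> counts the matches. The bound
  on \<open>card I\<close> is strict to leave room for the extra letter.\<close>

lemma expect_word_recursion:
  fixes k :: "'i \<Rightarrow> 'x::finite" and l :: "'j \<Rightarrow> 'x"
  assumes I: "finite I" "card I < N" and J: "finite J" "card J \<le> N"
  shows "expect (\<lambda>z. z x * (\<Prod>i\<in>I. z (k i)) * (\<Prod>j\<in>J. cnj (z (l j))))
    = (\<Sum>j\<in>J. if x = l j
        then expect (\<lambda>z. (\<Prod>i\<in>I. z (k i)) * (\<Prod>j\<in>J - {j}. cnj (z (l j)))) else 0)"
proof -
  define a where "a y = card {i \<in> I. k i = y}" for y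
  define b where "b y = card {j \<in> J. l j = y}" for y
  define rest where "rest = (\<Prod>y\<in>UNIV - {x}. factorial_moment (a y) (b y))"
  \<comment> \<open>The index \<open>None\<close> carries the extra letter \<open>x\<close>, so that
    the unconjugated part is again a single word.\<close>
  have a': "card {i \<in> insert None (Some ` I). case_option x k i = y} = (if y = x then Suc (a y) else a y)" for y
  proof -
    have "{i \<in> insert None (Some ` I). case_option x k i = y}
        = (if y = x then {None} else {}) \<union> Some ` {i \<in> I. k i = y}" by auto
    then show ?thesis using I by (auto simp: a_def card_image)
  qed
  have "expect (\<lambda>z. z x * (\<Prod>i\<in>I. z (k i)) * (\<Prod>j\<in>J. cnj (z (l j))))
      = expect (\<lambda>z. (\<Prod>i\<in>insert None (Some ` I). z (case_option x k i)) * (\<Prod>j\<in>J. cnj (z (l j))))"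
    using I by (simp add: prod.reindex)
  also have "\<dots> = (\<Prod>y\<in>UNIV. factorial_moment (if y = x then Suc (a y) else a y) (b y))"
    using I J by (subst expect_word) (simp_all add: a' b_def card_image del: insert_iff)
  also have "\<dots> = factorial_moment (Suc (a x)) (b x) * rest"
    unfolding rest_def by (subst prod.remove[of _ x]) auto
  also have "\<dots> = (\<Sum>j\<in>{j \<in> J. l j = x}. factorial_moment (a x) (b x - 1) * rest)"
    by (simp add: factorial_moment_Suc b_def)
  also have "\<dots> = (\<Sum>j\<in>{j \<in> J. l j = x}.
      expect (\<lambda>z. (\<Prod>i\<in>I. z (k i)) * (\<Prod>j\<in>J - {j}. cnj (z (l j)))))"
  proof (rule sum.cong[OF refl])
    fix j assume j: "j \<in> {j \<in> J. l j = x}"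
    have b': "card {j' \<in> J - {j}. l j' = y} = (if y = x then b x - 1 else b y)" for y
    proof -
      have "{j' \<in> J - {j}. l j' = y} = {j' \<in> J. l j' = y} - {j}" by auto
      then show ?thesis using j J by (auto simp: b_def)
    qed
    have "card (J - {j}) \<le> N" using J by (simp add: card_Diff_singleton_if le_diff_conv)
    then have "expect (\<lambda>z. (\<Prod>i\<in>I. z (k i)) * (\<Prod>j\<in>J - {j}. cnj (z (l j))))
        = (\<Prod>y\<in>UNIV. factorial_moment (a y) (if y = x then b x - 1 else b y))"
      using I J by (subst expect_word) (simp_all add: b' a_def del: Diff_iff)
    also have "\<dots> = factorial_moment (a x) (b x - 1) * rest"
      unfolding rest_def by (subst prod.remove[of _ x]) auto
    finally show "factorial_moment (a x) (b x - 1) * rest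
      = expect (\<lambda>z. (\<Prod>i\<in>I. z (k i)) * (\<Prod>j\<in>J - {j}. cnj (z (l j))))" ..
  qed
  finally show ?thesis using J by (simp add: sum.inter_filter eq_commute)
qed

text \<open>Induction on \<open>I\<close>: contract the letter at \<open>a\<close> with some
  \<open>j\<close>, then pair off the rest. Every permutation of \<open>insert a I\<close> is
  uniquely a transposition of \<open>a\<close> and \<open>j\<close> after a permutation of
  \<open>I\<close>.\<close>

lemma wick:
  fixes k l :: "'i \<Rightarrow> 'x::finite"
  assumes "finite I" "card I \<le> N"
  shows "expect (\<lambda>z. (\<Prod>i\<in>I. z (k i)) * (\<Prod>i\<in>I. cnj (z (l i))))
    = (\<Sum>p | p permutes I. if \<forall>i\<in>I. k i = l (p i) then 1 else 0)"
  using assms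
proof (induction I arbitrary: l)
  case empty
  then show ?case using expect_word[of "{}" "{}" k l] by (simp add: factorial_moment_def)
next
  case (insert a I)
  define F where "F l' = expect (\<lambda>z. (\<Prod>i\<in>I. z (k i)) * (\<Prod>i\<in>I. cnj (z (l' i))))" for l'
  have "expect (\<lambda>z. (\<Prod>i\<in>insert a I. z (k i)) * (\<Prod>i\<in>insert a I. cnj (z (l i))))
      = expect (\<lambda>z. z (k a) * (\<Prod>i\<in>I. z (k i)) * (\<Prod>i\<in>insert a I. cnj (z (l i))))"
    using insert.hyps by simp
  also have "\<dots> = (\<Sum>j\<in>insert a I. if k a = l j
      then expect (\<lambda>z. (\<Prod>i\<in>I. z (k i)) * (\<Prod>j\<in>insert a I - {j}. cnj (z (l j)))) else 0)"
    using insert.hyps insert.prems by (intro expect_word_recursion) auto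
  \<comment> \<open>The transposition relabels the remaining conjugate letters by \<open>I\<close>.
    This changes \<open>l\<close>, which is why the induction keeps \<open>l\<close>
    arbitrary.\<close>
  also have "\<dots> = (\<Sum>j\<in>insert a I. if k a = l j then F (l \<circ> Transposition.transpose a j) else 0)"
  proof (intro sum.cong refl if_cong)
    fix j assume j: "j \<in> insert a I"
    have "bij_betw (Transposition.transpose a j) I (insert a I - {j})"
      using j insert.hyps(2)
      by (intro bij_betw_byWitness[where f' = "Transposition.transpose a j"]) (auto simp: Transposition.transpose_def)
    then have "(\<Prod>j\<in>insert a I - {j}. cnj (z (l j))) = (\<Prod>i\<in>I. cnj (z ((l \<circ> Transposition.transpose a j) i)))" for z
      by (simp add: prod.reindex_bij_betw[symmetric])
    then show "expect (\<lambda>z. (\<Prod>i\<in>I. z (k i)) * (\<Prod>j\<in>insert a I - {j}. cnj (z (l j))))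
        = F (l \<circ> Transposition.transpose a j)" by (simp add: F_def)
  qed
  also have "\<dots> = (\<Sum>j\<in>insert a I. \<Sum>p | p permutes I.
      if \<forall>i\<in>insert a I. k i = l ((Transposition.transpose a j \<circ> p) i) then 1 else 0)"
  proof (rule sum.cong[OF refl])
    fix j
    have "F (l \<circ> Transposition.transpose a j)
        = (\<Sum>p | p permutes I. if \<forall>i\<in>I. k i = l (Transposition.transpose a j (p i)) then 1 else 0)"
      unfolding F_def using insert.IH[of "l \<circ> Transposition.transpose a j"] insert.hyps insert.prems by simp
    moreover have "(\<Sum>p | p permutes I.
        if \<forall>i\<in>insert a I. k i = l ((Transposition.transpose a j \<circ> p) i) then 1 else 0)
      = (\<Sum>p | p permutes I.
        if k a = l j \<and> (\<forall>i\<in>I. k i = l (Transposition.transpose a j (p i))) then 1 else (0 :: complex))"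
    proof (rule sum.cong[OF refl])
      fix p assume "p \<in> {p. p permutes I}"
      then have "p a = a" using insert.hyps(2) by (auto simp: permutes_def)
      then show "(if \<forall>i\<in>insert a I. k i = l ((Transposition.transpose a j \<circ> p) i) then 1 else 0)
        = (if k a = l j \<and> (\<forall>i\<in>I. k i = l (Transposition.transpose a j (p i))) then 1 else (0 :: complex))"
        by simp
    qed
    ultimately show "(if k a = l j then F (l \<circ> Transposition.transpose a j) else 0) = (\<Sum>p | p permutes I.
      if \<forall>i\<in>insert a I. k i = l ((Transposition.transpose a j \<circ> p) i) then 1 else 0)"
      by simp
  qed
  also have "\<dots> = (\<Sum>p | p permutes insert a I. if \<forall>i\<in>insert a I. k i = l (p i) then 1 else 0)"
    using insert.hyps by (subst sum_over_permutations_insert) auto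
  finally show ?case .
qed

text \<open>By Wick's theorem the sum runs over all rearrangements of \<open>l\<close>, and by
  invariance each of the \<open>fact CARD('n)\<close> permutations contributes
  \<open>s l\<close>.\<close>

lemma expect_symmetrize:
  fixes s :: "('n::finite \<Rightarrow> 'x::finite) \<Rightarrow> complex"
  assumes s: "\<And>p k. p permutes UNIV \<Longrightarrow> s (k \<circ> p) = s k" and N: "CARD('n) \<le> N"
  shows "(\<Sum>k\<in>UNIV. expect (\<lambda>z. (\<Prod>i\<in>UNIV. z (k i)) * (\<Prod>i\<in>UNIV. cnj (z (l i)))) * s k)
    = fact CARD('n) * s l"
proof -
  have "(\<Sum>k\<in>UNIV. expect (\<lambda>z. (\<Prod>i\<in>UNIV. z (k i)) * (\<Prod>i\<in>UNIV. cnj (z (l i)))) * s k)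
      = (\<Sum>k\<in>UNIV. \<Sum>p | p permutes UNIV. if k = l \<circ> p then s k else 0)"
    using N by (subst wick) (auto simp: sum_distrib_right fun_eq_iff intro!: sum.cong)
  also have "\<dots> = (\<Sum>p | p permutes UNIV. \<Sum>k\<in>UNIV. if k = l \<circ> p then s k else 0)"
    by (rule sum.swap)
  also have "\<dots> = (\<Sum>p | p permutes (UNIV :: 'n set). s l)"
    by (intro sum.cong refl) (simp add: s)
  finally show ?thesis by (simp add: card_permutations)
qed


end

section \<open>Existence of the quadrature\<close>

text \<open>
  If the moment vector of the exponential distribution were not in the convex hull of the moment
  curve, a separating hyperplane would give a nonzero polynomial that is nonnegative on \<open>[0, \<infinity>)\<close>
  and has expectation \<open>0\<close>.
\<close>

lemma exponential_quadrature:
  fixes e :: "'k::finite \<Rightarrow> nat"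
  assumes e: "inj e" "\<And>i. 0 < e i"
  obtains S u where "finite S" "S \<subseteq> {0::real..}" "\<And>t. t \<in> S \<Longrightarrow> 0 \<le> u t" "sum u S = 1"
    "\<And>i. (\<Sum>t\<in>S. u t * t ^ e i) = fact (e i)"
proof -
  define \<gamma> :: "real \<Rightarrow> real ^ 'k" where "\<gamma> t = (\<chi> i. t ^ e i)" for t
  define m :: "real ^ 'k" where "m = (\<chi> i. fact (e i))"
  have "m \<in> convex hull (\<gamma> ` {0..})"
  proof (rule ccontr)
    assume "m \<notin> convex hull (\<gamma> ` {0..})"
    then have "0 \<notin> (\<lambda>x. x - m) ` (convex hull (\<gamma> ` {0..}))" by auto
    moreover have "convex ((\<lambda>x. x - m) ` (convex hull (\<gamma> ` {0..})))"
      using convex_translation[OF convex_convex_hull, of "- m"] by (simp add: image_image)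
    ultimately obtain c where c: "c \<noteq> 0"
      and sep: "\<forall>x\<in>(\<lambda>x. x - m) ` (convex hull (\<gamma> ` {0..})). 0 \<le> c \<bullet> x"
      using separating_hyperplane_set_0 by blast
    \<comment> \<open>The separating functional along the moment curve, times the exponential
      density. The constant 1 is written \<open>t powr 0\<close> so that the Gamma integral covers
      it; since \<open>0 powr 0 = 0\<close>, this makes \<open>f 0 = 0\<close>, and
      \<open>f_eq\<close> is restricted to positive \<open>t\<close>.\<close>
    define f where "f t = (\<Sum>i\<in>UNIV. c $ i * (t powr real (e i) - fact (e i) * t powr 0)) / exp t" for t
    have powr: "t powr real (e i) = t ^ e i" if "0 \<le> t" for t i
      using that e(2)[of i] by (cases "t = 0") (auto simp: powr_realpow)
    have f_eq: "f t = (c \<bullet> (\<gamma> t - m)) / exp t" if "0 < t" for t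
      using that by (simp add: f_def \<gamma>_def m_def inner_vec_def powr)
    have f_nonneg: "0 \<le> f t" if "0 \<le> t" for t
    proof (cases "t = 0")
      case True
      then show ?thesis using e(2) by (simp add: f_def)
    next
      case False
      moreover have "\<gamma> t \<in> convex hull (\<gamma> ` {0..})" using that by (auto intro: hull_inc)
      ultimately show ?thesis using that sep by (simp add: f_eq)
    qed
    have "(f has_integral (\<Sum>i\<in>UNIV. c $ i * (fact (e i) - fact (e i) * 1))) {0..}"
    proof -
      have "((\<lambda>t. t powr real j / exp t) has_integral fact j) {0..}" for j :: nat
        using Gamma_integral_real[of "real j + 1"] Gamma_fact[of j, where 'a = real]
        by (simp add: add.commute)
      from this this[of 0] have "((\<lambda>t. \<Sum>i\<in>UNIV. c $ i * (t powr real (e i) / exp t - fact (e i) * (t powr 0 / exp t)))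
          has_integral (\<Sum>i\<in>UNIV. c $ i * (fact (e i) - fact (e i) * 1))) {0..}"
        by (intro has_integral_sum has_integral_mult_right has_integral_diff) simp_all
      then show ?thesis
        by (rule has_integral_eq[rotated]) (simp add: f_def sum_divide_distrib diff_divide_distrib algebra_simps)
    qed
    then have int0: "(f has_integral 0) {0..}" by simp
    \<comment> \<open>A nonnegative function with integral 0 vanishes wherever it is continuous. The
      interval from 1 to 2 stays away from 0, where \<open>t powr 0\<close> jumps.\<close>
    have cont: "continuous_on {1..2} f"
      unfolding f_def by (intro continuous_intros) auto
    then have "f integrable_on {1..2}" by (rule integrable_continuous_real)
    then have int12: "(f has_integral integral {1..2} f) {1..2}" by (rule integrable_integral)
    have "integral {1..2} f \<le> 0"
      by (rule has_integral_subset_le[OF _ int12 int0]) (auto intro: f_nonneg)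
    moreover have "0 \<le> integral {1..2} f"
      by (rule has_integral_nonneg[OF int12]) (auto intro: f_nonneg)
    ultimately have "(f has_integral 0) (cbox 1 2)" using int12 by simp
    then have f0: "f t = 0" if "t \<in> cbox 1 2" for t
      using that cont by (intro has_integral_0_cbox_imp_0[of 1 2 f]) (auto intro: f_nonneg)
    \<comment> \<open>As the exponents are distinct and positive, the coefficient of
      \<open>p\<close> at \<open>e j\<close> is exactly \<open>c $ j\<close>; the constant term does
      not interfere.\<close>
    define p where "p = (\<Sum>i\<in>UNIV. monom (c $ i) (e i)) - [:c \<bullet> m:]"
    have "poly p t = 0" if "t \<in> {1..2}" for t
      using f0[of t] f_eq[of t] that
      by (simp add: p_def poly_sum poly_monom inner_diff_right) (simp add: inner_vec_def \<gamma>_def)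
    then have "{1..2} \<subseteq> {t. poly p t = 0}" by blast
    moreover have "infinite {1..2::real}" by (rule infinite_Icc) simp
    ultimately have "infinite {t. poly p t = 0}" by (rule infinite_super)
    then have "p = 0" using poly_roots_finite by blast
    then have "coeff p (e j) = 0" for j by simp
    moreover have "coeff p (e j) = c $ j" for j
    proof -
      have "coeff p (e j) = (\<Sum>i\<in>UNIV. if i = j then c $ i else 0)"
        using e(1) e(2)[of j]
        by (auto simp: p_def coeff_sum coeff_pCons inj_eq split: nat.split intro!: sum.cong)
      then show ?thesis by simp
    qed
    ultimately show False using c by (simp add: vec_eq_iff)
  qed
  then obtain S u where S: "finite S" "S \<subseteq> \<gamma> ` {0..}" "\<forall>x\<in>S. 0 \<le> u x" "sum u S = 1"
    "(\<Sum>x\<in>S. u x *\<^sub>R x) = m"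
    unfolding convex_hull_explicit by blast
  \<comment> \<open>One parameter is chosen for each support point, so that weights on points of the
    curve become weights on parameters.\<close>
  obtain V where V: "V \<subseteq> {0..}" "inj_on \<gamma> V" "S = \<gamma> ` V" using S(2) by (auto simp: subset_image_inj)
  show ?thesis
  proof (rule that[of V "\<lambda>t. u (\<gamma> t)"])
    show "finite V" using S(1) V by (simp add: finite_image_iff)
    show "(\<Sum>t\<in>V. u (\<gamma> t)) = 1" using S(4) V by (simp add: sum.reindex)
    have "(\<Sum>t\<in>V. u (\<gamma> t) *\<^sub>R \<gamma> t) = m" using S(5) V by (simp add: sum.reindex)
    then have "(\<Sum>t\<in>V. u (\<gamma> t) *\<^sub>R \<gamma> t) $ i = m $ i" for i by simp
    then show "(\<Sum>t\<in>V. u (\<gamma> t) * t ^ e i) = fact (e i)" for i by (simp add: \<gamma>_def m_def)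
  qed (use S V in auto)
qed

text \<open>A geometric sum: for different exponents below \<open>M\<close> the difference is not
  divisible by \<open>M\<close>, so the ratio is an \<open>M\<close>-th root of unity other than
  1.\<close>

lemma sum_roots_of_unity:
  assumes "a < M" "b < M"
  shows "(\<Sum>j<M. cis (2 * pi * real j / real M) ^ a * cnj (cis (2 * pi * real j / real M)) ^ b)
    = (if a = b then of_nat M else 0)"
proof (cases "a = b")
  case True
  have "cis x ^ a * cnj (cis x) ^ a = 1" for x
    by (simp add: cis_cnj cis_mult flip: power_mult_distrib)
  then show ?thesis using True by simp
next
  case False
  define d where "d = real a - real b"
  define q where "q = cis (2 * pi * d / real M)"
  have M: "M > 0" using assms by simp
  have "cis (2 * pi * real j / real M) ^ a * cnj (cis (2 * pi * real j / real M)) ^ b = q ^ j" for j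
    by (simp add: q_def d_def cis_cnj Complex.DeMoivre cis_mult field_simps diff_divide_distrib)
  then have "(\<Sum>j<M. cis (2 * pi * real j / real M) ^ a * cnj (cis (2 * pi * real j / real M)) ^ b)
      = (\<Sum>j<M. q ^ j)" by simp
  also have "\<dots> = 0"
  proof -
    have "q ^ M = 1"
    proof -
      have "q ^ M = cis (2 * pi * real_of_int (int a - int b))"
        using M by (simp add: q_def d_def Complex.DeMoivre)
      also have "\<dots> = 1" by (rule cis_multiple_2pi) simp
      finally show ?thesis .
    qed
    moreover have "q \<noteq> 1"
    proof
      assume "q = 1"
      then have "cos (2 * pi * d / real M) = 1" by (simp add: q_def cis.ctr complex_eq_iff)
      then obtain z :: int where "2 * pi * d / real M = real_of_int z * 2 * pi"
        using cos_one_2pi_int by blast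
      then have "d = z * real M" using M by (simp add: field_simps)
      then have "real_of_int (int a - int b) = real_of_int (z * int M)" by (simp add: d_def)
      then have "int a - int b = z * int M" by (simp only: of_int_eq_iff)
      then have "int M dvd int a - int b" by simp
      then show False using dvd_imp_le_int[of "int a - int b" "int M"] assms False by simp
    qed
    ultimately show ?thesis by (simp add: geometric_sum)
  qed
  finally show ?thesis using False by simp
qed

text \<open>Polar coordinates: the squared modulus of a standard complex Gaussian is exponentially
  distributed and its angle is independent and uniform. The two are replaced by the exponential
  quadrature and by roots of unity. The type \<open>'k\<close> only supplies the degree.\<close>

lemma wick_quadrature_exists:
  "\<exists>(T :: (real \<times> nat) set) w Z. wick_quadrature T w Z CARD('k::finite)"
proof -
  define N where "N = CARD('k)"
  have "\<exists>e. bij_betw e (UNIV :: 'k set) {1..N}"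
    by (rule finite_same_card_bij) (simp_all add: N_def)
  \<comment> \<open>The positive exponents up to \<open>N\<close>; the moment of order 0 is the
    total weight.\<close>
  then obtain e :: "'k \<Rightarrow> nat" where e: "bij_betw e UNIV {1..N}" ..
  have "e i \<in> {1..N}" for i using e bij_betwE by blast
  then have e_pos: "0 < e i" for i by (simp add: Suc_le_eq)
  have "inj e" using e by (rule bij_betw_imp_inj_on)
  obtain S u where S: "finite S" "S \<subseteq> {0::real..}" "\<And>t. t \<in> S \<Longrightarrow> 0 \<le> u t" "sum u S = 1"
    "\<And>i. (\<Sum>t\<in>S. u t * t ^ e i) = fact (e i)"
    using exponential_quadrature[OF \<open>inj e\<close> e_pos] by metis
  have moments: "(\<Sum>t\<in>S. u t * t ^ a) = fact a" if "a \<le> N" for a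
  proof (cases "a = 0")
    case False
    then have "a \<in> e ` UNIV" using that e by (auto simp: bij_betw_def)
    then show ?thesis using S(5) by auto
  qed (use S(4) in simp)
  \<comment> \<open>One more than the largest exponent, so that different exponents remain different
    modulo \<open>M\<close>.\<close>
  define M where "M = Suc N"
  define w :: "real \<times> nat \<Rightarrow> real" where "w = (\<lambda>(t, j). u t / real M)"
  define Z :: "real \<times> nat \<Rightarrow> complex" where "Z = (\<lambda>(t, j). of_real (sqrt t) * cis (2 * pi * real j / real M))"
  have "wick_quadrature (S \<times> {..<M}) w Z N"
  proof
    fix a b assume ab: "a \<le> N" "b \<le> N"
    have "(\<Sum>x\<in>S \<times> {..<M}. of_real (w x) * (Z x ^ a * cnj (Z x) ^ b))
        = (\<Sum>t\<in>S. \<Sum>j<M. (of_real (u t / M) * (of_real (sqrt t) ^ a * of_real (sqrt t) ^ b)) *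
            (cis (2 * pi * real j / real M) ^ a * cnj (cis (2 * pi * real j / real M)) ^ b))"
      by (simp add: sum.cartesian_product case_prod_beta w_def Z_def power_mult_distrib mult_ac)
    also have "\<dots> = (\<Sum>t\<in>S. (of_real (u t / M) * (of_real (sqrt t) ^ a * of_real (sqrt t) ^ b)) *
        (if a = b then of_nat M else 0))"
      using ab by (simp only: sum_distrib_left[symmetric] sum_roots_of_unity M_def less_Suc_eq_le)
    also have "\<dots> = factorial_moment a b"
    proof (cases "a = b")
      case True
      have "(\<Sum>t\<in>S. (of_real (u t / M) * (of_real (sqrt t) ^ a * of_real (sqrt t) ^ a)) * of_nat M)
          = (\<Sum>t\<in>S. complex_of_real (u t * t ^ a))"
      proof (rule sum.cong[OF refl])
        fix t assume "t \<in> S"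
        then have "sqrt t ^ a * sqrt t ^ a = t ^ a"
          using S(2) by (auto simp flip: power_mult_distrib)
        then have r: "u t * t ^ a = u t / M * (sqrt t ^ a * sqrt t ^ a) * real M"
          by (simp add: M_def)
        show "(of_real (u t / M) * (of_real (sqrt t) ^ a * of_real (sqrt t) ^ a)) * of_nat M
            = complex_of_real (u t * t ^ a)"
          unfolding r by (simp only: of_real_mult of_real_power of_real_of_nat_eq)
      qed
      also have "\<dots> = of_real (fact a)"
        by (simp only: of_real_sum[symmetric] moments[OF ab(1)])
      finally show ?thesis using True by (simp add: factorial_moment_def)
    qed (simp add: factorial_moment_def)
    finally show "(\<Sum>x\<in>S \<times> {..<M}. of_real (w x) * (Z x ^ a * cnj (Z x) ^ b)) = factorial_moment a b" .
  qed (use S in \<open>auto simp: w_def\<close>)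
  then show ?thesis unfolding N_def by blast
qed

section \<open>Contractions of one additional pair of letters\<close>

context wick_quadrature
begin

text \<open>The letter \<open>z x\<close> meets either its own partner \<open>cnj (z y)\<close>, or
  a letter of the conjugate word at some position \<open>j\<close>, in which case
  \<open>cnj (z y)\<close> takes over that position.\<close>

lemma expect_word_insert:
  fixes m k :: "'n::finite \<Rightarrow> 'x::finite"
  assumes N: "CARD('n) < N"
  defines "W \<equiv> \<lambda>k. expect (\<lambda>z. (\<Prod>i\<in>UNIV. z (m i)) * (\<Prod>i\<in>UNIV. cnj (z (k i))))"
  shows "expect (\<lambda>z. z x * cnj (z y) * ((\<Prod>i\<in>UNIV. z (m i)) * (\<Prod>i\<in>UNIV. cnj (z (k i)))))
    = (if x = y then W k else 0) + (\<Sum>j\<in>UNIV. if x = k j then W (k(j := y)) else 0)"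
proof -
  \<comment> \<open>The conjugate word with \<open>cnj (z y)\<close> added at the index
    \<open>None\<close>.\<close>
  define l where "l = case_option y k"
  have l: "l None = y" "l (Some j) = k j" for j by (simp_all add: l_def)
  have fin: "finite (range (Some :: 'n \<Rightarrow> _))" "None \<notin> range (Some :: 'n \<Rightarrow> _)" by auto
  have prod_l: "(\<Prod>j\<in>insert None (range Some). cnj (z (l j))) = cnj (z y) * (\<Prod>i\<in>UNIV. cnj (z (k i)))" for z
    using fin by (simp add: l_def prod.reindex)
  have prod_None: "(\<Prod>j\<in>insert None (range Some) - {None}. cnj (z (l j))) = (\<Prod>i\<in>UNIV. cnj (z (k i)))" for z
    using fin by (simp add: l_def prod.reindex)
  have prod_Some: "(\<Prod>j\<in>insert None (range Some) - {Some j}. cnj (z (l j)))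
      = (\<Prod>i\<in>UNIV. cnj (z ((k(j := y)) i)))" for z j
  proof -
    have "insert None (range Some) - {Some j} = insert None (Some ` (UNIV - {j}))" by auto
    then have "(\<Prod>j\<in>insert None (range Some) - {Some j}. cnj (z (l j)))
        = cnj (z y) * (\<Prod>i\<in>UNIV - {j}. cnj (z (k i)))"
      by (simp add: l_def prod.reindex)
    also have "\<dots> = (\<Prod>i\<in>UNIV. cnj (z ((k(j := y)) i)))"
      by (subst prod.remove[of UNIV j]) auto
    finally show ?thesis .
  qed
  have "expect (\<lambda>z. z x * cnj (z y) * ((\<Prod>i\<in>UNIV. z (m i)) * (\<Prod>i\<in>UNIV. cnj (z (k i)))))
      = expect (\<lambda>z. z x * (\<Prod>i\<in>UNIV. z (m i)) * (\<Prod>j\<in>insert None (range Some). cnj (z (l j))))"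
    unfolding prod_l by (simp add: mult_ac)
  also have "\<dots> = (\<Sum>j\<in>insert None (range Some). if x = l j then expect (\<lambda>z. (\<Prod>i\<in>UNIV. z (m i)) *
      (\<Prod>j\<in>insert None (range Some) - {j}. cnj (z (l j)))) else 0)"
    using N by (intro expect_word_recursion) (auto simp: card_image)
  also have "\<dots> = (if x = y then W k else 0) + (\<Sum>j\<in>UNIV. if x = k j then W (k(j := y)) else 0)"
    unfolding sum.insert[OF fin] sum.reindex[OF inj_Some] comp_def prod_None prod_Some l W_def ..
  finally show ?thesis .
qed

text \<open>After the contraction of \<open>z x\<close>, the sum over \<open>m\<close> of what
  remains is evaluated by \<open>expect_symmetrize\<close>, using the symmetry of
  \<open>t\<close>.\<close>

lemma expect_bilinear:
  fixes s t :: "('n::finite \<Rightarrow> 'x::finite) \<Rightarrow> complex"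
  assumes t: "\<And>p k. p permutes UNIV \<Longrightarrow> t (k \<circ> p) = t k" and N: "CARD('n) < N"
  shows "expect (\<lambda>z. z x * cnj (z y) * ((\<Sum>k\<in>UNIV. (\<Prod>i\<in>UNIV. cnj (z (k i))) * s k) *
      (\<Sum>m\<in>UNIV. (\<Prod>i\<in>UNIV. z (m i)) * t m)))
    = fact CARD('n) * ((if x = y then \<Sum>k\<in>UNIV. s k * t k else 0) +
        (\<Sum>k\<in>UNIV. \<Sum>j\<in>UNIV. if x = k j then s k * t (k(j := y)) else 0))"
proof -
  define W where "W m k = expect (\<lambda>z :: 'x \<Rightarrow> complex. (\<Prod>i\<in>UNIV. z (m i)) * (\<Prod>i\<in>UNIV. cnj (z (k i))))"
    for m k :: "'n \<Rightarrow> 'x"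
  have W: "(\<Sum>m\<in>UNIV. W m k * t m) = fact CARD('n) * t k" for k
    unfolding W_def using t N by (intro expect_symmetrize) auto
  have "expect (\<lambda>z. z x * cnj (z y) * ((\<Sum>k\<in>UNIV. (\<Prod>i\<in>UNIV. cnj (z (k i))) * s k) *
      (\<Sum>m\<in>UNIV. (\<Prod>i\<in>UNIV. z (m i)) * t m)))
    = expect (\<lambda>z. \<Sum>k\<in>UNIV. \<Sum>m\<in>UNIV.
        z x * cnj (z y) * ((\<Prod>i\<in>UNIV. z (m i)) * (\<Prod>i\<in>UNIV. cnj (z (k i)))) * (s k * t m))"
    by (simp add: sum_product sum_distrib_left mult_ac)
  also have "\<dots> = (\<Sum>k\<in>UNIV. \<Sum>m\<in>UNIV. ((if x = y then W m k else 0) +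
      (\<Sum>j\<in>UNIV. if x = k j then W m (k(j := y)) else 0)) * (s k * t m))"
    by (simp only: expect_sum expect_mult_right expect_word_insert[OF N] W_def)
  also have "\<dots> = (\<Sum>k\<in>UNIV. (if x = y then s k * (\<Sum>m\<in>UNIV. W m k * t m) else 0) +
      (\<Sum>j\<in>UNIV. if x = k j then s k * (\<Sum>m\<in>UNIV. W m (k(j := y)) * t m) else 0))"
  proof (rule sum.cong[OF refl])
    fix k
    have "(\<Sum>m\<in>UNIV. ((if x = y then W m k else 0) +
        (\<Sum>j\<in>UNIV. if x = k j then W m (k(j := y)) else 0)) * (s k * t m))
      = (\<Sum>m\<in>UNIV. if x = y then s k * (W m k * t m) else 0) +
        (\<Sum>m\<in>UNIV. \<Sum>j\<in>UNIV. if x = k j then s k * (W m (k(j := y)) * t m) else 0)"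
      unfolding sum.distrib[symmetric]
      by (intro sum.cong refl)
        (simp only: distrib_right distrib_left sum_distrib_right sum_distrib_left mult_delta_left mult_delta_right mult.left_commute)
    also have "(\<Sum>m\<in>UNIV. \<Sum>j\<in>UNIV. if x = k j then s k * (W m (k(j := y)) * t m) else 0)
      = (\<Sum>j\<in>UNIV. \<Sum>m\<in>UNIV. if x = k j then s k * (W m (k(j := y)) * t m) else 0)"
      by (rule sum.swap)
    also have "\<dots> = (\<Sum>j\<in>UNIV. if x = k j then s k * (\<Sum>m\<in>UNIV. W m (k(j := y)) * t m) else 0)"
      by (intro sum.cong refl) (simp add: sum_distrib_left)
    also have "(\<Sum>m\<in>UNIV. if x = y then s k * (W m k * t m) else 0)
      = (if x = y then s k * (\<Sum>m\<in>UNIV. W m k * t m) else 0)"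
      by (simp add: sum_distrib_left)
    finally show "(\<Sum>m\<in>UNIV. ((if x = y then W m k else 0) +
        (\<Sum>j\<in>UNIV. if x = k j then W m (k(j := y)) else 0)) * (s k * t m))
      = (if x = y then s k * (\<Sum>m\<in>UNIV. W m k * t m) else 0) +
        (\<Sum>j\<in>UNIV. if x = k j then s k * (\<Sum>m\<in>UNIV. W m (k(j := y)) * t m) else 0)" .
  qed
  also have "\<dots> = fact CARD('n) * ((if x = y then \<Sum>k\<in>UNIV. s k * t k else 0) +
        (\<Sum>k\<in>UNIV. \<Sum>j\<in>UNIV. if x = k j then s k * t (k(j := y)) else 0))"
    unfolding W
    by (auto simp: sum.distrib sum_distrib_left distrib_left mult_ac intro!: sum.cong)
  finally show ?thesis .
qed

end

text \<open>A word in the entries of a matrix, that is in pairs of indices, amounts to a row and a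
  column index of the tensor power of the matrix.\<close>

lemma sum_pair_functions:
  fixes F :: "('n::finite \<Rightarrow> 'a::finite) \<Rightarrow> ('n \<Rightarrow> 'b::finite) \<Rightarrow> 'c::comm_monoid_add"
  shows "(\<Sum>k\<in>UNIV. F (fst \<circ> k) (snd \<circ> k)) = (\<Sum>f\<in>UNIV. \<Sum>f'\<in>UNIV. F f f')"
  unfolding sum.cartesian_product
  by (rule sum.reindex_bij_witness[where j = "\<lambda>k. (fst \<circ> k, snd \<circ> k)" and i = "\<lambda>(f, f') i. (f i, f' i)"])
    (auto simp: comp_def)

section \<open>Permutations of the first tensor power\<close>

definition shift :: "('n \<Rightarrow> 'n) \<Rightarrow> ('n \<Rightarrow> 'a) \<times> 'y \<Rightarrow> ('n \<Rightarrow> 'a) \<times> 'y" where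
  "shift \<sigma> p = (fst p \<circ> \<sigma>, snd p)"

definition perm_left :: "('n \<Rightarrow> 'n) \<Rightarrow> (('n::finite \<Rightarrow> 'a::finite) \<times> 'y::finite) operator" where
  "perm_left \<sigma> = tensor_op (perm_op \<sigma>) (mat 1)"

lemma perm_left_nth: "perm_left \<sigma> $ p $ q = (if q = shift \<sigma> p then 1 else 0)"
  by (auto simp: perm_left_def tensor_op_def perm_op_def mat_def shift_def prod_eq_iff)

lemma perm_left_mult_nth: "(perm_left \<sigma> ** X) $ p $ q = X $ shift \<sigma> p $ q"
  by (simp add: matrix_matrix_mult_def perm_left_nth mult_delta_left)

lemma mult_dagger_perm_left_nth: "(X ** dagger (perm_left \<sigma>)) $ p $ q = X $ p $ shift \<sigma> q"
  by (simp add: matrix_matrix_mult_def dagger_def perm_left_nth if_distrib[of cnj] mult_delta_right cong: if_cong)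

lemma perm_left_unitary:
  assumes \<sigma>: "\<sigma> permutes UNIV"
  shows perm_left_mult_dagger: "perm_left \<sigma> ** dagger (perm_left \<sigma>)
      = (mat 1 :: (('n::finite \<Rightarrow> 'a::finite) \<times> 'y::finite) operator)"
    and perm_left_dagger_mult: "dagger (perm_left \<sigma>) ** perm_left \<sigma>
      = (mat 1 :: (('n \<Rightarrow> 'a) \<times> 'y) operator)"
proof -
  have "surj \<sigma>" using \<sigma> by (rule permutes_surj)
  then have "fst p \<circ> \<sigma> = fst q \<circ> \<sigma> \<longleftrightarrow> fst p = fst q" for p q :: "('n \<Rightarrow> 'a) \<times> 'y"
    using surj_fun_eq[of \<sigma> UNIV "fst p" "fst q"] by (auto simp: fun_eq_iff)
  then have "shift \<sigma> p = shift \<sigma> q \<longleftrightarrow> p = q" for p q :: "('n \<Rightarrow> 'a) \<times> 'y"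
    by (auto simp: shift_def prod_eq_iff)
  then have "(perm_left \<sigma> ** dagger (perm_left \<sigma>)) $ p $ q = mat 1 $ p $ q" for p q :: "('n \<Rightarrow> 'a) \<times> 'y"
    unfolding mult_dagger_perm_left_nth by (auto simp: perm_left_nth mat_def)
  then show "perm_left \<sigma> ** dagger (perm_left \<sigma>) = (mat 1 :: (('n \<Rightarrow> 'a) \<times> 'y) operator)"
    by (simp add: vec_eq_iff)
  then show "dagger (perm_left \<sigma>) ** perm_left \<sigma> = (mat 1 :: (('n \<Rightarrow> 'a) \<times> 'y) operator)"
    by (simp add: matrix_left_right_inverse)
qed

lemma perm_left_invariant_nth:
  assumes "perm_left \<sigma> ** R ** dagger (perm_left \<sigma>) = R"
  shows "R $ shift \<sigma> p $ shift \<sigma> q = R $ p $ q"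
  using assms by (metis mult_dagger_perm_left_nth perm_left_mult_nth)

text \<open>Invariance under conjugation by a unitary means commuting with it, which passes to the
  square root.\<close>

lemma psd_sqrt_perm_left_invariant:
  assumes R: "psd R" and \<sigma>: "\<sigma> permutes UNIV"
    and inv: "perm_left \<sigma> ** R ** dagger (perm_left \<sigma>) = R"
  shows "perm_left \<sigma> ** psd_sqrt R ** dagger (perm_left \<sigma>) = psd_sqrt R"
proof -
  have "R ** perm_left \<sigma> = perm_left \<sigma> ** R ** (dagger (perm_left \<sigma>) ** perm_left \<sigma>)"
    using inv by (simp add: matrix_mul_assoc)
  then have "perm_left \<sigma> ** R = R ** perm_left \<sigma>"
    by (simp add: perm_left_mult_dagger[OF \<sigma>] perm_left_dagger_mult[OF \<sigma>] matrix_mul_rid)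
  from psd_sqrt_commute[OF R this]
  have "perm_left \<sigma> ** psd_sqrt R ** dagger (perm_left \<sigma>)
      = psd_sqrt R ** (perm_left \<sigma> ** dagger (perm_left \<sigma>))"
    by (simp add: matrix_mul_assoc)
  then show ?thesis by (simp add: perm_left_mult_dagger[OF \<sigma>] perm_left_dagger_mult[OF \<sigma>] matrix_mul_rid)
qed

section \<open>Separability\<close>

definition trace_left :: "('a::finite \<times> 'b::finite) operator \<Rightarrow> 'b operator" where
  "trace_left \<rho> = (\<chi> b b'. \<Sum>a\<in>UNIV. \<rho> $ (a, b) $ (a, b'))"

text \<open>The index that is traced out joins the column index of the Gram operator.\<close>

lemma psd_trace_left:
  assumes "psd \<rho>"
  shows "psd (trace_left \<rho>)"
proof -
  obtain v :: "'a \<times> 'b \<Rightarrow> 'a \<times> 'b \<Rightarrow> complex" where v: "\<rho> = gram v UNIV" using psd_gramE[OF assms] .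
  have "trace_left \<rho> = gram (\<lambda>b (a, k). v (a, b) k) UNIV"
    by (simp add: v trace_left_def gram_def vec_eq_iff sum.cartesian_product case_prod_beta
        flip: UNIV_Times_UNIV)
  then show ?thesis by (simp add: psd_gram)
qed

lemma trace_trace_left: "trace (trace_left \<rho>) = trace \<rho>"
proof -
  have "trace (trace_left \<rho>) = (\<Sum>a\<in>UNIV. \<Sum>b\<in>UNIV. \<rho> $ (a, b) $ (a, b))"
    unfolding trace_def trace_left_def by (simp add: sum.swap[of _ "UNIV :: 'b set"])
  then show ?thesis
    by (simp add: trace_def sum.cartesian_product case_prod_beta flip: UNIV_Times_UNIV)
qed

lemma psd_mat_1: "psd (mat 1)"
  by (simp add: psd_iff_inner) (auto simp: dagger_def mat_def vec_eq_iff)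

lemma marginal_nth:
  "marginal j l R $ (a, b) $ (a', b')
    = (\<Sum>g\<in>{g. g l = b}. \<Sum>f\<in>{f. f j = a}. R $ (f, g) $ (f(j := a'), g(l := b')))"
proof -
  have "{(f, g). f j = a \<and> g l = b} = {f. f j = a} \<times> {g. g l = b}" by auto
  then have "marginal j l R $ (a, b) $ (a', b')
      = (\<Sum>f\<in>{f. f j = a}. \<Sum>g\<in>{g. g l = b}. R $ (f, g) $ (f(j := a'), g(l := b')))"
    by (simp add: marginal_def sum.cartesian_product)
  also have "\<dots> = (\<Sum>g\<in>{g. g l = b}. \<Sum>f\<in>{f. f j = a}. R $ (f, g) $ (f(j := a'), g(l := b')))"
    by (rule sum.swap)
  finally show ?thesis .
qed

text \<open>The dummy value \<open>c\<close> at \<open>l\<close> makes the set of the traced-out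
  coordinates independent of \<open>b\<close>, so that it can serve as a common column index in
  \<open>gram\<close>.\<close>

lemma sum_over_fixed_coordinate:
  fixes F :: "('n \<Rightarrow> 'b) \<Rightarrow> ('n \<Rightarrow> 'b) \<Rightarrow> 'c::comm_monoid_add"
  shows "(\<Sum>g\<in>{g. g l = b}. F g (g(l := b'))) = (\<Sum>h\<in>{h. h l = c}. F (h(l := b)) (h(l := b')))"
  by (rule sum.reindex_bij_witness[where j = "\<lambda>g. g(l := c)" and i = "\<lambda>h. h(l := b)"]) auto

text \<open>Conjugation by the transposition of \<open>j\<close> and \<open>j'\<close> exchanges the
  two factors. Hence the contractions at the \<open>n\<close> positions all produce the same
  operator.\<close>

lemma marginal_perm_left:
  fixes R :: "(('n::finite \<Rightarrow> 'a::finite) \<times> ('n \<Rightarrow> 'b::finite)) operator"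
  assumes "\<And>\<sigma>. \<sigma> permutes UNIV \<Longrightarrow> perm_left \<sigma> ** R ** dagger (perm_left \<sigma>) = R"
  shows "marginal j l R = marginal j' l R"
proof -
  define \<tau> where "\<tau> = Transposition.transpose j j'"
  have \<tau>: "\<tau> permutes UNIV" unfolding \<tau>_def by (intro permutes_swap_id) auto
  have inv: "R $ (f \<circ> \<tau>, g) $ (f' \<circ> \<tau>, g') = R $ (f, g) $ (f', g')" for f f' g g'
    using perm_left_invariant_nth[OF assms[OF \<tau>], of "(f, g)" "(f', g')"] by (simp add: shift_def)
  have upd: "(f(j' := a)) \<circ> \<tau> = (f \<circ> \<tau>)(j := a)" for f and a :: 'a
    by (auto simp: \<tau>_def fun_eq_iff Transposition.transpose_def)
  have \<tau>\<tau>: "f \<circ> \<tau> \<circ> \<tau> = f" for f :: "'n \<Rightarrow> 'a"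
    by (auto simp: \<tau>_def fun_eq_iff)
  have "(\<Sum>f\<in>{f. f j = a}. R $ (f, g) $ (f(j := a'), g'))
      = (\<Sum>f\<in>{f. f j' = a}. R $ (f, g) $ (f(j' := a'), g'))" for a a' g g'
  proof (rule sum.reindex_bij_witness[where i = "\<lambda>f. f \<circ> \<tau>" and j = "\<lambda>f. f \<circ> \<tau>"])
    fix f assume "f \<in> {f. f j = a}"
    show "R $ (f \<circ> \<tau>, g) $ ((f \<circ> \<tau>)(j' := a'), g') = R $ (f, g) $ (f(j := a'), g')"
      using inv[of "f \<circ> \<tau>" g "(f \<circ> \<tau>)(j' := a')" g'] by (simp only: upd \<tau>\<tau>)
  qed (auto simp: \<tau>\<tau>, auto simp: \<tau>_def)
  then show ?thesis by (simp add: vec_eq_iff marginal_nth split_paired_all)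
qed

context wick_quadrature
begin

text \<open>With \<open>z\<close> as the entries of a random matrix, \<open>X z\<close> is that
  matrix times its adjoint. \<open>Y z\<close> is the Gram operator of the contracted root of
  \<open>R\<close>, reduced to copy \<open>l\<close> of the second factor.\<close>

lemma expect_gram_gram:
  fixes R :: "(('n::finite \<Rightarrow> 'a::finite) \<times> ('n \<Rightarrow> 'b::finite)) operator"
    and c :: 'b and l :: 'n
  assumes R: "psd R" and N: "CARD('n) < N"
    and inv: "\<And>\<sigma>. \<sigma> permutes UNIV \<Longrightarrow> perm_left \<sigma> ** R ** dagger (perm_left \<sigma>) = R"
  defines "X \<equiv> \<lambda>z :: 'a \<times> 'a \<Rightarrow> complex. gram (\<lambda>p q. z (p, q)) UNIV"
    and "Y \<equiv> \<lambda>z. gram (\<lambda>b (h, g'). \<Sum>k\<in>UNIV. (\<Prod>i\<in>UNIV. cnj (z (k i))) *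
        psd_sqrt R $ (fst \<circ> k, h(l := b)) $ (snd \<circ> k, g')) ({h. h l = c} \<times> UNIV)"
  shows "expect (\<lambda>z. X z $ p $ p' * Y z $ b $ b')
    = fact CARD('n) * (of_nat CARD('n) * marginal l l R $ (p, b) $ (p', b')
        + (if p = p' then of_nat CARD('a) * trace_left (marginal l l R) $ b $ b' else 0))"
proof -
  define S where "S = psd_sqrt R"
  define s where "s g g' k = S $ (fst \<circ> k, g) $ (snd \<circ> k, g')" for g g' and k :: "'n \<Rightarrow> 'a \<times> 'a"
  define A where "A z g g' = (\<Sum>k\<in>UNIV. (\<Prod>i\<in>UNIV. cnj (z (k i))) * s g g' k)"
    for z :: "'a \<times> 'a \<Rightarrow> complex" and g g'
  define RA where "RA g h = (\<Sum>f\<in>UNIV. R $ (f, g) $ (f, h))" for g h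
  define RM where "RM j g h = (\<Sum>f\<in>{f. f j = p}. R $ (f, g) $ (f(j := p'), h))" for j g h
  \<comment> \<open>Permuting a word permutes its row and column indices simultaneously. The
    conjugate appears because it plays the role of \<open>t\<close> in
    \<open>expect_bilinear\<close>.\<close>
  have s_sym: "cnj (s g g' (k \<circ> \<sigma>)) = cnj (s g g' k)" if "\<sigma> permutes UNIV" for g g' k \<sigma>
    using perm_left_invariant_nth[OF psd_sqrt_perm_left_invariant[OF R that inv[OF that]],
        of "(fst \<circ> k, g)" "(snd \<circ> k, g')"]
    by (simp add: s_def S_def shift_def comp_assoc)
  have gramR: "(\<Sum>f'\<in>UNIV. \<Sum>g'\<in>UNIV. S $ (f, g) $ (f', g') * cnj (S $ (f2, h) $ (f', g')))
      = R $ (f, g) $ (f2, h)" for f g f2 h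
    unfolding S_def by (subst (3) psd_eq_gram[OF R])
      (simp add: gram_def sum.cartesian_product case_prod_beta flip: UNIV_Times_UNIV)
  have first: "(\<Sum>g'\<in>UNIV. \<Sum>k\<in>UNIV. s g g' k * cnj (s h g' k)) = RA g h" for g h
  proof -
    have "(\<Sum>g'\<in>UNIV. \<Sum>k\<in>UNIV. s g g' k * cnj (s h g' k))
        = (\<Sum>k\<in>UNIV. \<Sum>g'\<in>UNIV. s g g' k * cnj (s h g' k))" by (rule sum.swap)
    also have "\<dots> = (\<Sum>f\<in>UNIV. \<Sum>f'\<in>UNIV. \<Sum>g'\<in>UNIV. S $ (f, g) $ (f', g') * cnj (S $ (f, h) $ (f', g')))"
      unfolding s_def by (rule sum_pair_functions)
    finally show ?thesis by (simp add: gramR RA_def)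
  qed
  \<comment> \<open>The condition forces \<open>q = snd (k j)\<close>, which removes the sum over
    \<open>q\<close>. The contraction then only changes the row index at \<open>j\<close> from
    \<open>p\<close> to \<open>p'\<close>, and summing over the columns of the root rebuilds
    \<open>R\<close>.\<close>
  have second: "(\<Sum>q\<in>UNIV. \<Sum>g'\<in>UNIV. \<Sum>k\<in>UNIV. \<Sum>j\<in>UNIV.
      if (p, q) = k j then s g g' k * cnj (s h g' (k(j := (p', q)))) else 0) = (\<Sum>j\<in>UNIV. RM j g h)"
    for g h
  proof -
    have "(\<Sum>q\<in>UNIV. \<Sum>g'\<in>UNIV. \<Sum>k\<in>UNIV. \<Sum>j\<in>UNIV.
        if (p, q) = k j then s g g' k * cnj (s h g' (k(j := (p', q)))) else 0)
      = (\<Sum>g'\<in>UNIV. \<Sum>k\<in>UNIV. \<Sum>j\<in>UNIV. \<Sum>q\<in>UNIV.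
        if (p, q) = k j then s g g' k * cnj (s h g' (k(j := (p', q)))) else 0)"
      by (subst sum.swap) (simp only: sum.swap[of _ "UNIV :: 'n set" "UNIV :: 'a set"]
          sum.swap[of _ "UNIV :: ('n \<Rightarrow> 'a \<times> 'a) set" "UNIV :: 'a set"])
    also have "\<dots> = (\<Sum>g'\<in>UNIV. \<Sum>k\<in>UNIV. \<Sum>j\<in>UNIV. if p = fst (k j)
        then S $ (fst \<circ> k, g) $ (snd \<circ> k, g') * cnj (S $ ((fst \<circ> k)(j := p'), h) $ (snd \<circ> k, g')) else 0)"
    proof (intro sum.cong refl)
      fix g' j and k :: "'n \<Rightarrow> 'a \<times> 'a"
      have "(\<Sum>q\<in>UNIV. if (p, q) = k j then s g g' k * cnj (s h g' (k(j := (p', q)))) else 0)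
          = (\<Sum>q\<in>UNIV. if q = snd (k j) then
              if p = fst (k j) then s g g' k * cnj (s h g' (k(j := (p', snd (k j))))) else 0 else 0)"
        by (intro sum.cong refl) (auto simp: prod_eq_iff)
      moreover have "fst \<circ> k(j := (p', snd (k j))) = (fst \<circ> k)(j := p')"
        "snd \<circ> k(j := (p', snd (k j))) = snd \<circ> k" by auto
      ultimately show "(\<Sum>q\<in>UNIV. if (p, q) = k j then s g g' k * cnj (s h g' (k(j := (p', q)))) else 0)
        = (if p = fst (k j) then S $ (fst \<circ> k, g) $ (snd \<circ> k, g') *
            cnj (S $ ((fst \<circ> k)(j := p'), h) $ (snd \<circ> k, g')) else 0)"
        by (simp add: s_def)
    qed
    also have "\<dots> = (\<Sum>k\<in>UNIV. \<Sum>j\<in>UNIV. \<Sum>g'\<in>UNIV. if p = (fst \<circ> k) j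
        then S $ (fst \<circ> k, g) $ (snd \<circ> k, g') * cnj (S $ ((fst \<circ> k)(j := p'), h) $ (snd \<circ> k, g')) else 0)"
      by (subst sum.swap) (simp add: sum.swap[of _ "UNIV :: 'n set" "UNIV :: ('n \<Rightarrow> 'b) set"])
    also have "\<dots> = (\<Sum>f\<in>UNIV. \<Sum>f'\<in>UNIV. \<Sum>j\<in>UNIV. \<Sum>g'\<in>UNIV. if p = f j
        then S $ (f, g) $ (f', g') * cnj (S $ (f(j := p'), h) $ (f', g')) else 0)"
      by (rule sum_pair_functions)
    also have "\<dots> = (\<Sum>f\<in>UNIV. \<Sum>j\<in>UNIV. \<Sum>f'\<in>UNIV. \<Sum>g'\<in>UNIV. if p = f j
        then S $ (f, g) $ (f', g') * cnj (S $ (f(j := p'), h) $ (f', g')) else 0)"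
      by (intro sum.cong refl sum.swap)
    also have "\<dots> = (\<Sum>f\<in>UNIV. \<Sum>j\<in>UNIV. if p = f j then R $ (f, g) $ (f(j := p'), h) else 0)"
      by (intro sum.cong refl) (simp add: gramR)
    also have "\<dots> = (\<Sum>j\<in>UNIV. \<Sum>f\<in>UNIV. if f j = p then R $ (f, g) $ (f(j := p'), h) else 0)"
      by (subst sum.swap) (simp add: eq_commute)
    finally show ?thesis by (simp add: RM_def sum.If_cases)
  qed
  have X: "X z $ p $ p' = (\<Sum>q\<in>UNIV. z (p, q) * cnj (z (p', q)))" for z
    by (simp add: X_def gram_def)
  have Y: "Y z $ b $ b' = (\<Sum>h\<in>{h. h l = c}. \<Sum>g'\<in>UNIV. A z (h(l := b)) g' * cnj (A z (h(l := b')) g'))" for z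
    by (simp add: Y_def gram_def A_def s_def S_def sum.cartesian_product case_prod_beta)
  have cnj_A: "cnj (A z g g') = (\<Sum>m\<in>UNIV. (\<Prod>i\<in>UNIV. z (m i)) * cnj (s g g' m))" for z g g'
    by (simp add: A_def)
  define n where "n = CARD('n)"
  have E: "(\<Sum>q\<in>UNIV. \<Sum>g'\<in>UNIV. expect (\<lambda>z. z (p, q) * cnj (z (p', q)) * (A z g g' * cnj (A z h g'))))
      = fact n * ((if p = p' then of_nat CARD('a) * RA g h else 0) + (\<Sum>j\<in>UNIV. RM j g h))" for g h
  proof -
    have "(\<Sum>q\<in>UNIV. \<Sum>g'\<in>UNIV. expect (\<lambda>z. z (p, q) * cnj (z (p', q)) * (A z g g' * cnj (A z h g'))))
      = (\<Sum>q\<in>UNIV. \<Sum>g'\<in>UNIV. fact n * ((if (p, q) = (p', q) then \<Sum>k\<in>UNIV. s g g' k * cnj (s h g' k) else 0) +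
        (\<Sum>k\<in>UNIV. \<Sum>j\<in>UNIV. if (p, q) = k j then s g g' k * cnj (s h g' (k(j := (p', q)))) else 0)))"
      unfolding cnj_A unfolding A_def n_def
      by (intro sum.cong refl expect_bilinear[OF _ N]) (rule s_sym)
    also have "\<dots> = fact n * ((if p = p' then \<Sum>q\<in>(UNIV :: 'a set). \<Sum>g'\<in>UNIV. \<Sum>k\<in>UNIV. s g g' k * cnj (s h g' k) else 0)
      + (\<Sum>q\<in>UNIV. \<Sum>g'\<in>UNIV. \<Sum>k\<in>UNIV. \<Sum>j\<in>UNIV. if (p, q) = k j then s g g' k * cnj (s h g' (k(j := (p', q)))) else 0))"
      by (simp add: sum_distrib_left[symmetric] sum.distrib)
    finally show ?thesis unfolding second first by simp
  qed
  have RM: "(\<Sum>h\<in>{h. h l = c}. RM j (h(l := b)) (h(l := b'))) = marginal l l R $ (p, b) $ (p', b')" for j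
  proof -
    have "(\<Sum>h\<in>{h. h l = c}. RM j (h(l := b)) (h(l := b'))) = marginal j l R $ (p, b) $ (p', b')"
      unfolding marginal_nth RM_def by (rule sum_over_fixed_coordinate[symmetric])
    then show ?thesis using marginal_perm_left[OF inv, of j l l] by simp
  qed
  have RA: "(\<Sum>h\<in>{h. h l = c}. RA (h(l := b)) (h(l := b'))) = trace_left (marginal l l R) $ b $ b'"
  proof -
    \<comment> \<open>Fixing the value at \<open>l\<close> and then summing over that value exhausts
      all row indices.\<close>
    have "(\<Sum>a\<in>UNIV. \<Sum>f\<in>{f. f l = a}. R $ (f, g) $ (f(l := a), h)) = RA g h" for g h
    proof -
      have "RA g h = (\<Sum>a\<in>UNIV. \<Sum>f\<in>{f \<in> UNIV. f l = a}. R $ (f, g) $ (f, h))"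
        unfolding RA_def by (intro sum.group[symmetric]) auto
      also have "\<dots> = (\<Sum>a\<in>UNIV. \<Sum>f\<in>{f. f l = a}. R $ (f, g) $ (f(l := a), h))"
        by (intro sum.cong) auto
      finally show ?thesis ..
    qed
    moreover have "trace_left (marginal l l R) $ b $ b'
        = (\<Sum>g\<in>{g. g l = b}. \<Sum>a\<in>UNIV. \<Sum>f\<in>{f. f l = a}. R $ (f, g) $ (f(l := a), g(l := b')))"
      unfolding trace_left_def vec_lambda_beta marginal_nth by (rule sum.swap)
    ultimately have "trace_left (marginal l l R) $ b $ b' = (\<Sum>g\<in>{g. g l = b}. RA g (g(l := b')))"
      by simp
    then show ?thesis by (simp only: sum_over_fixed_coordinate[where c = c])
  qed
  have "expect (\<lambda>z. X z $ p $ p' * Y z $ b $ b')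
      = expect (\<lambda>z. \<Sum>h\<in>{h. h l = c}. \<Sum>q\<in>UNIV. \<Sum>g'\<in>UNIV.
          z (p, q) * cnj (z (p', q)) * (A z (h(l := b)) g' * cnj (A z (h(l := b')) g')))"
    unfolding X Y sum_product by (subst sum.swap) (simp add: sum_distrib_left)
  also have "\<dots> = (\<Sum>h\<in>{h. h l = c}. fact n *
      ((if p = p' then of_nat CARD('a) * RA (h(l := b)) (h(l := b')) else 0) + (\<Sum>j\<in>UNIV. RM j (h(l := b)) (h(l := b')))))"
    by (simp only: expect_sum E)
  also have "\<dots> = fact n * ((if p = p' then of_nat CARD('a) * (\<Sum>h\<in>{h. h l = c}. RA (h(l := b)) (h(l := b'))) else 0)
      + (\<Sum>j\<in>UNIV. \<Sum>h\<in>{h. h l = c}. RM j (h(l := b)) (h(l := b'))))"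
    by (simp add: sum_distrib_left[symmetric] sum.distrib sum.swap[of _ UNIV])
  finally show ?thesis unfolding RM RA by (simp add: n_def algebra_simps)
qed

end

text \<open>The operator is the expectation from \<open>expect_gram_gram\<close> divided by its
  trace. Finite support turns the expectation into a finite nonnegative combination of tensor
  products of positive operators.\<close>

lemma separable_approximation:
  fixes R :: "(('n::finite \<Rightarrow> 'a::finite) \<times> ('n \<Rightarrow> 'b::finite)) operator"
  assumes R: "psd R"
    and inv: "\<And>\<sigma>. \<sigma> permutes UNIV \<Longrightarrow> perm_left \<sigma> ** R ** dagger (perm_left \<sigma>) = R"
    and \<rho>: "marginal l l R = \<rho>" "trace \<rho> = 1"
  shows "(1 / (real CARD('n) + (real CARD('a))\<^sup>2)) *\<^sub>R
    (real CARD('n) *\<^sub>R \<rho> + real CARD('a) *\<^sub>R tensor_op (mat 1) (trace_left \<rho>)) \<in> SEP"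
proof -
  define n where "n = real CARD('n)"
  define d where "d = real CARD('a)"
  define \<rho>' where "\<rho>' = (1 / (n + d\<^sup>2)) *\<^sub>R (n *\<^sub>R \<rho> + d *\<^sub>R tensor_op (mat 1) (trace_left \<rho>))"
  \<comment> \<open>\<open>'n option\<close> supplies degree \<open>n + 1\<close>: \<open>n\<close>
    letters from the tensor power and one from the additional matrix.\<close>
  obtain T :: "(real \<times> nat) set" and w Z where "wick_quadrature T w Z CARD('n option)"
    using wick_quadrature_exists by blast
  then interpret wick_quadrature T w Z "CARD('n option)" .
  define c :: 'b where "c = undefined"
  define X where "X = (\<lambda>z :: 'a \<times> 'a \<Rightarrow> complex. gram (\<lambda>p q. z (p, q)) UNIV)"
  define Y where "Y = (\<lambda>z. gram (\<lambda>b (h, g'). \<Sum>k\<in>UNIV. (\<Prod>i\<in>UNIV. cnj (z (k i))) *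
        psd_sqrt R $ (fst \<circ> k, h(l := b)) $ (snd \<circ> k, g')) ({h. h l = c} \<times> UNIV))"
  \<comment> \<open>The trace of the expected operator.\<close>
  define K where "K = fact CARD('n) * (n + d\<^sup>2)"
  have pos: "0 < n + d\<^sup>2" by (simp add: n_def d_def add_pos_nonneg)
  then have K: "0 < K" by (simp add: K_def)
  have nth: "(\<Sum>\<omega>\<in>UNIV \<rightarrow>\<^sub>E T. (weight \<omega> / K) *\<^sub>R tensor_op (X (\<lambda>x. Z (\<omega> x))) (Y (\<lambda>x. Z (\<omega> x)))) $ (p, b) $ (p', b')
      = \<rho>' $ (p, b) $ (p', b')" for p p' b b'
  proof -
    have "(\<Sum>\<omega>\<in>UNIV \<rightarrow>\<^sub>E T. (weight \<omega> / K) *\<^sub>R tensor_op (X (\<lambda>x. Z (\<omega> x))) (Y (\<lambda>x. Z (\<omega> x)))) $ (p, b) $ (p', b')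
      = (1 / K) *\<^sub>R expect (\<lambda>z. X z $ p $ p' * Y z $ b $ b')"
      by (simp add: expect_def tensor_op_def scaleR_sum_right)
        (simp add: scaleR_conv_of_real)
    also have "\<dots> = (1 / K) *\<^sub>R (fact CARD('n) * (of_nat CARD('n) * \<rho> $ (p, b) $ (p', b')
        + (if p = p' then of_nat CARD('a) * trace_left \<rho> $ b $ b' else 0)))"
      using expect_gram_gram[OF R _ inv, where l = l and c = c and p = p and p' = p' and b = b and b' = b'] \<rho>(1) by (simp add: X_def Y_def)
    also have "\<dots> = \<rho>' $ (p, b) $ (p', b')"
      using pos by (simp add: \<rho>'_def tensor_op_def mat_def)
        (simp add: K_def n_def d_def scaleR_conv_of_real)
    finally show ?thesis .
  qed
  have sum_eq: "(\<Sum>\<omega>\<in>UNIV \<rightarrow>\<^sub>E T. (weight \<omega> / K) *\<^sub>R tensor_op (X (\<lambda>x. Z (\<omega> x))) (Y (\<lambda>x. Z (\<omega> x)))) = \<rho>'"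
    unfolding vec_eq_iff split_paired_All by (intro allI nth)
  have "trace \<rho>' = (1 / (n + d\<^sup>2)) *\<^sub>R (n *\<^sub>R 1 + d *\<^sub>R (of_real d * 1))"
    by (simp add: \<rho>'_def trace_scaleR trace_add trace_tensor trace_trace_left \<rho>(2) trace_I d_def)
  also have "\<dots> = of_real ((1 / (n + d\<^sup>2)) * (n + d * d))"
    by (simp add: scaleR_conv_of_real)
  also have "\<dots> = 1" using pos by (simp add: power2_eq_square)
  finally have "trace \<rho>' = 1" .
  then have "(\<Sum>\<omega>\<in>UNIV \<rightarrow>\<^sub>E T. (weight \<omega> / K) *\<^sub>R tensor_op (X (\<lambda>x. Z (\<omega> x))) (Y (\<lambda>x. Z (\<omega> x)))) \<in> SEP"
    using K unfolding sum_eq[symmetric]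
    by (intro sum_tensor_in_SEP finite_sample_space)
      (auto simp: X_def Y_def psd_gram intro!: divide_nonneg_pos weight_nonneg)
  then show ?thesis unfolding sum_eq by (simp add: \<rho>'_def n_def d_def)
qed

section \<open>The rate and the conclusion\<close>

lemma one_le_2_ln_2: "1 \<le> 2 * ln (2::real)"
  using ln_le_minus_one[of "1/2 :: real"] by (simp add: ln_div)

text \<open>For \<open>d\<close> at least 2 the square root is at least \<open>d / 2\<close>, since
  \<open>2 * ln 2\<close> and the logarithm are at least 1 and \<open>d\<^sup>2 - 1\<close> is at
  least a quarter of \<open>d\<^sup>2\<close>. Hence the right side is at least
  \<open>2 * d\<^sup>2 / n\<close>.\<close>

lemma de_finetti_rate_bound:
  fixes d e n :: real
  assumes d: "2 \<le> d" and e: "1 \<le> e" and n: "1 \<le> n"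
  shows "2 * d\<^sup>2 / (n + d\<^sup>2) \<le> 4 * d * e * (sqrt (2 * ln 2 * (d\<^sup>2 - 1) * log 2 (n + d)) / n)"
proof -
  have dd: "4 \<le> d\<^sup>2" using power_mono[OF d, of 2] by simp
  have "1 \<le> log 2 (n + d)" using d n by (subst le_log_iff) auto
  then have "1 * (d\<^sup>2 - 1) * 1 \<le> 2 * ln 2 * (d\<^sup>2 - 1) * log 2 (n + d)"
    using one_le_2_ln_2 dd by (intro mult_mono) auto
  moreover have "(d / 2)\<^sup>2 \<le> 1 * (d\<^sup>2 - 1) * 1" using dd by (simp add: power_divide)
  ultimately have "(d / 2)\<^sup>2 \<le> 2 * ln 2 * (d\<^sup>2 - 1) * log 2 (n + d)" by linarith
  then have sqrt: "d / 2 \<le> sqrt (2 * ln 2 * (d\<^sup>2 - 1) * log 2 (n + d))"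
    by (rule real_le_rsqrt)
  have "2 * d\<^sup>2 / (n + d\<^sup>2) \<le> 2 * d\<^sup>2 / n"
    using n by (intro divide_left_mono) (auto intro!: mult_pos_pos add_pos_nonneg)
  also have "\<dots> = 4 * d * 1 * (d / 2 / n)" by (simp add: power2_eq_square)
  also have "\<dots> \<le> 4 * d * e * (sqrt (2 * ln 2 * (d\<^sup>2 - 1) * log 2 (n + d)) / n)"
    using d e n sqrt by (intro mult_mono divide_right_mono) auto
  finally show ?thesis .
qed

theorem theorem5p1:
  fixes \<rho> :: "('a::finite \<times> 'b::finite) operator"
    and dA dB n :: real
  defines "dA \<equiv> real CARD('a)" and "dB \<equiv> real CARD('b)"
    and "n \<equiv> real CARD('n::{finite,linorder})"
  assumes "density_op \<rho>"
    and "admits_perm_inv_extension TYPE('n) \<rho>"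
  shows "\<exists>\<rho>'\<in>SEP. trace_norm (\<rho> - \<rho>')
           \<le> 4 * dA * dB * (sqrt (2 * ln 2 * (dA\<^sup>2 - 1) * log 2 (n + dA)) / n)"
proof -
  obtain R :: "(('n \<Rightarrow> 'a) \<times> ('n \<Rightarrow> 'b)) operator" where R: "perm_inv_extension R \<rho>"
    using assms(5) by (auto simp: admits_perm_inv_extension_def)
  define \<tau> where "\<tau> = tensor_op (mat 1 :: 'a operator) (trace_left \<rho>)"
  define \<rho>' where "\<rho>' = (1 / (n + dA\<^sup>2)) *\<^sub>R (n *\<^sub>R \<rho> + dA *\<^sub>R \<tau>)"
  have n: "1 \<le> n" by (simp add: n_def Suc_le_eq)
  have dA: "1 \<le> dA" by (simp add: dA_def Suc_le_eq)
  have dB: "1 \<le> dB" by (simp add: dB_def Suc_le_eq)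
  have pos: "0 < n + dA\<^sup>2" using n by (simp add: add_pos_nonneg)
  have \<rho>: "psd \<rho>" "trace \<rho> = 1" using assms(4) by (auto simp: density_op_def)
  have sep: "\<rho>' \<in> SEP"
    unfolding \<rho>'_def \<tau>_def n_def dA_def
    using R \<rho>(2) by (intro separable_approximation[of R "Min UNIV"])
      (auto simp: perm_inv_extension_def density_op_def perm_left_def)
  have "trace_norm (\<rho> - \<rho>') \<le> 4 * dA * dB * (sqrt (2 * ln 2 * (dA\<^sup>2 - 1) * log 2 (n + dA)) / n)"
  proof (cases "dA = 1")
    \<comment> \<open>Here the claimed bound is 0, so \<open>\<rho>'\<close> has to equal
      \<open>\<rho>\<close>. It does, because tracing out a one-dimensional factor and tensoring
      with its identity changes nothing.\<close>
    case True
    then have "CARD('a) = 1" by (simp add: dA_def)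
    then have eq: "p = p'" for p p' :: 'a by (metis UNIV_I card_1_singletonE singletonD)
    then have univ: "UNIV = {p}" for p :: 'a by blast
    have "(\<Sum>a\<in>UNIV. f a) = f p" for f :: "'a \<Rightarrow> complex" and p
      by (subst univ[of p]) simp
    then have nth: "\<tau> $ (p, b) $ (p, b') = \<rho> $ (p, b) $ (p, b')" for p b b'
      by (simp add: \<tau>_def tensor_op_def mat_def trace_left_def)
    have "\<tau> $ (p, b) $ (p', b') = \<rho> $ (p, b) $ (p', b')" for p p' b b'
      using nth[of p b b'] eq[of p' p] by simp
    then have "\<tau> = \<rho>" by (simp add: vec_eq_iff split_paired_all)
    moreover have "n *\<^sub>R \<rho> + \<rho> = (n + 1) *\<^sub>R \<rho>" by (simp add: scaleR_left_distrib)
    ultimately have "\<rho>' = \<rho>" using True pos by (simp add: \<rho>'_def)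
    moreover have "trace_norm (0 - 0 :: ('a \<times> 'b) operator) \<le> 0"
      using trace_norm_diff_le[of "0 :: ('a \<times> 'b) operator" 0] psd_scaleR[OF \<rho>(1), of 0]
      by (simp add: trace_def)
    ultimately show ?thesis using True by simp
  next
    case False
    then have "CARD('a) \<noteq> 1" by (simp add: dA_def)
    moreover have "0 < CARD('a)" by simp
    ultimately have "2 \<le> CARD('a)" by linarith
    then have "2 \<le> dA" by (simp add: dA_def)
    \<comment> \<open>Over the common denominator the multiples of \<open>n\<close> cancel. What
      remains is a difference of two positive operators, each of trace
      \<open>dA\<^sup>2 / (n + dA\<^sup>2)\<close>.\<close>
    have "\<rho> = (1 / (n + dA\<^sup>2)) *\<^sub>R ((n + dA\<^sup>2) *\<^sub>R \<rho>)" using pos by simp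
    then have "\<rho> - \<rho>' = (dA\<^sup>2 / (n + dA\<^sup>2)) *\<^sub>R \<rho> - (dA / (n + dA\<^sup>2)) *\<^sub>R \<tau>"
      unfolding \<rho>'_def by (simp add: algebra_simps)
    also have "trace_norm \<dots> \<le> Re (trace ((dA\<^sup>2 / (n + dA\<^sup>2)) *\<^sub>R \<rho>)) + Re (trace ((dA / (n + dA\<^sup>2)) *\<^sub>R \<tau>))"
      using dA pos \<rho>(1) by (intro trace_norm_diff_le psd_scaleR)
        (auto simp: \<tau>_def intro!: psd_tensor psd_mat_1 psd_trace_left)
    also have "\<dots> = 2 * dA\<^sup>2 / (n + dA\<^sup>2)"
      by (simp add: trace_scaleR \<tau>_def trace_tensor trace_trace_left \<rho>(2) trace_I dA_def power2_eq_square)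
    also have "\<dots> \<le> 4 * dA * dB * (sqrt (2 * ln 2 * (dA\<^sup>2 - 1) * log 2 (n + dA)) / n)"
      by (rule de_finetti_rate_bound[OF \<open>2 \<le> dA\<close> dB n])
    finally show ?thesis .
  qed
  with sep show ?thesis by blast
qed

end
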